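(* Let $f_1,f_2,f_3,f_4:\mathbb{R}^+\to\mathbb{R}^+$ be strongly hyperbolic functions. Let $\mathcal{C}:=\mathcal{C}^-(f_1,f_2)\cup\mathcal{C}^+(f_3,f_4)$. Then $\mathcal{M}(f_1,f_2;f_3,f_4):=(\mathcal{P},\mathcal{C})$, with $(+)$-parallel classes the verticals $\{x_0\}\times\mathbb{S}^1$ and $(-)$-parallel classes the horizontals $\mathbb{S}^1\times\{y_0\}$, is a flat Minkowski plane.
   Context: Identify $\mathbb{S}^1$ with $\mathbb{R}\cup\{\infty\}$ (one-point compactification) and let $\mathcal{P}=\mathbb{S}^1\times\mathbb{S}^1$; $\mathbb{R}^+=(0,\infty)$. Two points are $(+)$-parallel if they have the same first coordinate, $(-)$-parallel if they have the same second coordinate, and parallel if either holds. A flat Minkowski plane is a geometry with point set $\mathcal{P}$, whose circles are graphs of homeomorphisms of $\mathbb{S}^1$, whose $(+)$-parallel classes are the verticals and $(-)$-parallel classes the horizontals, satisfying: (Joining) any three pairwise nonparallel points lie on a unique circle; (Touching) for each circle $C$ and nonparallel points $p\in C$, $q\notin C$, there is exactly one circle $D$ with $p,q\in D$ and $C\cap D=\{p\}$. A function $f:\mathbb{R}^+\to\mathbb{R}^+$ is strongly hyperbolic if: (1) $\lim_{x\to0+}f(x)=+\infty$ and $\lim_{x\to+\infty}f(x)=0$; (2) $f$ is strictly convex; (3) for each $b\in\mathbb{R}$, $\lim_{x\to+\infty}f(x+b)/f(x)=1$; (4) $f$ is differentiable; (5) $x\mapsto\ln|f'(x)|$ is strictly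 convex. For strongly hyperbolic $f_1,f_2$ and $a>0$, $b,c\in\mathbb{R}$, define $f_{a,b,c}:\mathbb{R}\setminus\{-b\}\to\mathbb{R}\setminus\{c\}$ by $f_{a,b,c}(x)=af_1(x+b)+c$ for $x>-b$ and $f_{a,b,c}(x)=-af_2(-x-b)+c$ for $x<-b$. Let $\overline{f_{a,b,c}}=\{(x,f_{a,b,c}(x)):x\neq-b\}\cup\{(-b,\infty),(\infty,c)\}$ and, for $s,t\in\mathbb{R}$, $\overline{l_{s,t}}=\{(x,sx+t):x\in\mathbb{R}\}\cup\{(\infty,\infty)\}$. Define $\mathcal{C}^-(f_1,f_2)=\{\overline{f_{a,b,c}}:a>0,b,c\in\mathbb{R}\}\cup\{\overline{l_{s,t}}:s<0,t\in\mathbb{R}\}$, and $\mathcal{C}^+(f_1,f_2)=\varphi(\mathcal{C}^-(f_1,f_2))$ (image of each set), where $\varphi(x,y)=(-x,y)$ with $-\infty=\infty$. *)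

theory Defs
  imports "HOL-Analysis.Analysis"
begin

section \<open>The circle S^1 = R \<union> {\<infinity>} (one-point compactification)\<close>

datatype s1 = Fin real | Infty

instantiation s1 :: topological_space
begin

definition open_s1 :: "s1 set \<Rightarrow> bool" where
  "open_s1 U \<longleftrightarrow> open {x. Fin x \<in> U} \<and>
     (Infty \<in> U \<longrightarrow> (\<exists>M. \<forall>x. M < \<bar>x\<bar> \<longrightarrow> Fin x \<in> U))"

instance
proof
  show "open (UNIV :: s1 set)" by (simp add: open_s1_def)
next
  fix S T :: "s1 set"
  assume S: "open S" and T: "open T"
  have "{x. Fin x \<in> S \<inter> T} = {x. Fin x \<in> S} \<inter> {x. Fin x \<in> T}" by auto
  moreover have "open ({x. Fin x \<in> S} \<inter> {x. Fin x \<in> T})"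
    using S T by (auto simp: open_s1_def)
  moreover have "\<exists>M. \<forall>x. M < \<bar>x\<bar> \<longrightarrow> Fin x \<in> S \<inter> T" if inf: "Infty \<in> S \<inter> T"
  proof -
    obtain M1 where "\<forall>x. M1 < \<bar>x\<bar> \<longrightarrow> Fin x \<in> S" using S inf by (auto simp: open_s1_def)
    moreover obtain M2 where "\<forall>x. M2 < \<bar>x\<bar> \<longrightarrow> Fin x \<in> T" using T inf by (auto simp: open_s1_def)
    ultimately show ?thesis by (intro exI[of _ "max M1 M2"]) auto
  qed
  ultimately show "open (S \<inter> T)" by (simp add: open_s1_def)
next
  fix K :: "s1 set set"
  assume K: "\<forall>S\<in>K. open S"
  have "{x. Fin x \<in> \<Union>K} = (\<Union>S\<in>K. {x. Fin x \<in> S})" by auto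
  moreover have "open (\<Union>S\<in>K. {x. Fin x \<in> S})" using K by (auto simp: open_s1_def)
  moreover have "\<exists>M. \<forall>x. M < \<bar>x\<bar> \<longrightarrow> Fin x \<in> \<Union>K" if inf: "Infty \<in> \<Union>K"
  proof -
    obtain S where "S \<in> K" "Infty \<in> S" using inf by auto
    then obtain M where "\<forall>x. M < \<bar>x\<bar> \<longrightarrow> Fin x \<in> S" using K by (auto simp: open_s1_def)
    then show ?thesis using \<open>S \<in> K\<close> by blast
  qed
  ultimately show "open (\<Union>K)" by (simp add: open_s1_def)
qed

end

type_synonym point = "s1 \<times> s1"

definition plus_parallel :: "point \<Rightarrow> point \<Rightarrow> bool" where
  "plus_parallel p q \<longleftrightarrow> fst p = fst q"

definition minus_parallel :: "point \<Rightarrow> point \<Rightarrow> bool" where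
  "minus_parallel p q \<longleftrightarrow> snd p = snd q"

definition parallel :: "point \<Rightarrow> point \<Rightarrow> bool" where
  "parallel p q \<longleftrightarrow> plus_parallel p q \<or> minus_parallel p q"

definition flat_minkowski_plane :: "point set set \<Rightarrow> bool" where
  "flat_minkowski_plane \<C> \<longleftrightarrow>
     (\<forall>C\<in>\<C>. \<exists>g h. homeomorphism (UNIV :: s1 set) (UNIV :: s1 set) g h \<and> C = {(x, g x) | x. True}) \<and>
     (\<forall>p q r. \<not> parallel p q \<and> \<not> parallel p r \<and> \<not> parallel q r \<longrightarrow>
        (\<exists>!C. C \<in> \<C> \<and> p \<in> C \<and> q \<in> C \<and> r \<in> C)) \<and>
     (\<forall>C\<in>\<C>. \<forall>p q. p \<in> C \<and> q \<notin> C \<and> \<not> parallel p q \<longrightarrow>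
        (\<exists>!D. D \<in> \<C> \<and> p \<in> D \<and> q \<in> D \<and> C \<inter> D = {p}))"

definition strictly_convex_on :: "real set \<Rightarrow> (real \<Rightarrow> real) \<Rightarrow> bool" where
  "strictly_convex_on S f \<longleftrightarrow>
     (\<forall>x\<in>S. \<forall>y\<in>S. \<forall>t. x \<noteq> y \<and> 0 < t \<and> t < 1 \<longrightarrow>
        f ((1 - t) * x + t * y) < (1 - t) * f x + t * f y)"

text \<open>f : R^+ \<rightarrow> R^+ is represented by a total function real \<Rightarrow> real whose values
  outside (0,\<infinity>) are irrelevant.\<close>
definition strongly_hyperbolic :: "(real \<Rightarrow> real) \<Rightarrow> bool" where
  "strongly_hyperbolic f \<longleftrightarrow>
     (\<forall>x>0. f x > 0) \<and>
     filterlim f at_top (at_right 0) \<and>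
     (f \<longlongrightarrow> 0) at_top \<and>
     strictly_convex_on {0<..} f \<and>
     (\<forall>b::real. ((\<lambda>x. f (x + b) / f x) \<longlongrightarrow> 1) at_top) \<and>
     (\<forall>x>0. f differentiable (at x)) \<and>
     strictly_convex_on {0<..} (\<lambda>x. ln \<bar>deriv f x\<bar>)"

definition f_abc :: "(real \<Rightarrow> real) \<Rightarrow> (real \<Rightarrow> real) \<Rightarrow> real \<Rightarrow> real \<Rightarrow> real \<Rightarrow> real \<Rightarrow> real" where
  "f_abc f1 f2 a b c x = (if x > -b then a * f1 (x + b) + c else - a * f2 (- x - b) + c)"

definition f_circle :: "(real \<Rightarrow> real) \<Rightarrow> (real \<Rightarrow> real) \<Rightarrow> real \<Rightarrow> real \<Rightarrow> real \<Rightarrow> point set" where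
  "f_circle f1 f2 a b c =
     {(Fin x, Fin (f_abc f1 f2 a b c x)) | x. x \<noteq> -b} \<union> {(Fin (-b), Infty), (Infty, Fin c)}"

definition l_circle :: "real \<Rightarrow> real \<Rightarrow> point set" where
  "l_circle s t = {(Fin x, Fin (s * x + t)) | x. True} \<union> {(Infty, Infty)}"

definition C_minus :: "(real \<Rightarrow> real) \<Rightarrow> (real \<Rightarrow> real) \<Rightarrow> point set set" where
  "C_minus f1 f2 =
     {f_circle f1 f2 a b c | a b c. a > 0} \<union> {l_circle s t | s t. s < 0}"

fun s1_neg :: "s1 \<Rightarrow> s1" where
  "s1_neg (Fin x) = Fin (- x)"
| "s1_neg Infty = Infty"

definition phi :: "point \<Rightarrow> point" where
  "phi p = (s1_neg (fst p), snd p)"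

definition C_plus :: "(real \<Rightarrow> real) \<Rightarrow> (real \<Rightarrow> real) \<Rightarrow> point set set" where
  "C_plus f1 f2 = (\<lambda>C. phi ` C) ` C_minus f1 f2"

end

theory Submission
  imports Defs
begin

text \<open>
  Every circle in \<open>\<C>\<^sup>-\<close> is the graph of a bijection of the circle that reverses the cyclic order, every
  circle in \<open>\<C>\<^sup>+\<close> is one of a bijection that preserves it. Such bijections are homeomorphisms, and the
  cyclic orientation of three points decides which of the two families can join them. Within
  \<open>\<C>\<^sup>-\<close> joining amounts to solving one equation for the horizontal shift \<open>b\<close>: eliminating \<open>a\<close> and \<open>c\<close>
  leaves a ratio of differences of values of \<open>f\<^sub>1\<close> and \<open>f\<^sub>2\<close>, which is strictly monotone in \<open>b\<close>
  because \<open>ln |f'|\<close> is strictly convex (through Cauchy's mean value theorem), and whose limits are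
  governed by \<open>f(x + b) / f(x) \<longrightarrow> 1\<close>.

  For touching at a finite point \<open>p\<close>, the same method shows that there is exactly one circle in \<open>\<C>\<^sup>-\<close> through
  \<open>p\<close> and \<open>q\<close> with a prescribed negative slope at \<open>p\<close>. Circles with different slopes cross at \<open>p\<close> and
  therefore meet again; by uniqueness, circles with the same slope do not. A circle in \<open>\<C>\<^sup>-\<close> and one in
  \<open>\<C>\<^sup>+\<close> through \<open>p\<close> always meet a second time.
\<close>

section \<open>Strongly hyperbolic functions\<close>

text \<open>Nothing relates \<open>f1\<close> to \<open>f2\<close>, so a triple split by the pole
  cannot be reduced to one on a single branch: each position of the points relative to the pole
  yields its own equation. Whenever the pole is unknown, the unknown \<open>u\<close> is the
  distance of one point from it. No second derivative is assumed; monotonicity in \<open>u\<close>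
  comes from comparing difference quotients with \<open>deriv f (x + d) / deriv f x\<close>, which
  increases in \<open>x\<close>. The limit law speaks of \<open>f\<close> only; together with the
  decay to 0 it gives the one estimate on \<open>deriv f\<close> that fixes the admissible ratios.
  At a point with an infinite coordinate there is no slope to prescribe. Its place is taken by the
  factor \<open>a\<close> (at a pole or at a finite level over infinity) or by the slope of a line:
  equal parameters mean tangency, unequal ones produce an explicit second common point.\<close>

lemma strictly_convex_imp_convex:
  assumes "strictly_convex_on S f" "convex S"
  shows "convex_on S f"
proof (rule convex_onI)
  fix t x y :: real assume "0 < t" "t < 1" "x \<in> S" "y \<in> S"
  then show "f ((1 - t) *\<^sub>R x + t *\<^sub>R y) \<le> (1 - t) * f x + t * f y"
    using assms(1)[unfolded strictly_convex_on_def, rule_format, of x y t]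
    by (cases "x = y") (simp_all add: left_diff_distrib)
qed (fact assms(2))

text \<open>Both inner points lie on the segment from \<open>u\<close> to \<open>v + d\<close>, with
  weights \<open>t\<close> and \<open>1 - t\<close> that exchange the ends, so the two convexity
  inequalities add up to the claim.\<close>

lemma strictly_convex_crossing:
  assumes "strictly_convex_on S g" "u \<in> S" "v + d \<in> S" "u < v" "0 < d"
  shows "g (u + d) + g v < g u + g (v + d)"
proof -
  define t where "t = d / (v + d - u)"
  have t: "0 < t" "t < 1" using assms by (auto simp: t_def field_simps)
  have td: "t * (v + d - u) = d" using assms by (simp add: t_def)
  have e1: "u + d = (1 - t) * u + t * (v + d)" using td by (simp add: algebra_simps)
  have e2: "v = (1 - (1 - t)) * u + (1 - t) * (v + d)" using td by (simp add: algebra_simps)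
  have "u \<noteq> v + d" using assms by auto
  then have "g ((1 - t) * u + t * (v + d)) < (1 - t) * g u + t * g (v + d)"
    and "g ((1 - (1 - t)) * u + (1 - t) * (v + d)) < (1 - (1 - t)) * g u + (1 - t) * g (v + d)"
    using assms(2,3) t assms(1)[unfolded strictly_convex_on_def, rule_format, of u "v + d" t]
      assms(1)[unfolded strictly_convex_on_def, rule_format, of u "v + d" "1 - t"] by auto
  then show ?thesis unfolding e1[symmetric] e2[symmetric] by (simp add: algebra_simps)
qed

text \<open>Common frame for the equations of the shift: strict monotonicity gives uniqueness, and
  two witnesses with values on either side of \<open>y\<close> replace limits at the ends of the
  interval.\<close>

lemma connected_ex1_value_decreasing:
  fixes F :: "real \<Rightarrow> real"
  assumes "connected I" "continuous_on I F"
    and dec: "\<And>u v. \<lbrakk>u \<in> I; v \<in> I; u < v\<rbrakk> \<Longrightarrow> F v < F u"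
    and "u \<in> I" "F u < y" "v \<in> I" "y < F v"
  shows "\<exists>!x. x \<in> I \<and> F x = y"
proof -
  have "connected (F ` I)" using assms(1,2) by (rule connected_continuous_image[rotated])
  then have "y \<in> F ` I"
    using connectedD_interval[of "F ` I" "F u" "F v" y] assms(4-) by auto
  then show ?thesis using dec by (metis imageE linorder_neqE less_irrefl)
qed

lemma connected_ex1_value_increasing:
  fixes F :: "real \<Rightarrow> real"
  assumes "connected I" "continuous_on I F"
    and inc: "\<And>u v. \<lbrakk>u \<in> I; v \<in> I; u < v\<rbrakk> \<Longrightarrow> F u < F v"
    and "u \<in> I" "F u < y" "v \<in> I" "y < F v"
  shows "\<exists>!x. x \<in> I \<and> F x = y"
  using connected_ex1_value_decreasing[of I "\<lambda>x. - F x" v "- y" u] assms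
  by (auto intro: continuous_on_minus)

section \<open>Monotonicity and regularity of one strongly hyperbolic function\<close>

context
  fixes f :: "real \<Rightarrow> real"
  assumes sh: "strongly_hyperbolic f"
begin

lemma sh_pos: "0 < x \<Longrightarrow> 0 < f x"
  using sh by (simp add: strongly_hyperbolic_def)

lemma sh_deriv: "0 < x \<Longrightarrow> (f has_real_derivative deriv f x) (at x)"
  using sh unfolding strongly_hyperbolic_def
  by (meson DERIV_deriv_iff_real_differentiable)

lemma sh_tendsto: "(f \<longlongrightarrow> 0) at_top"
  using sh by (simp add: strongly_hyperbolic_def)

lemma sh_convex: "convex_on {0<..} f"
  using sh by (intro strictly_convex_imp_convex) (auto simp: strongly_hyperbolic_def)

lemma sh_tangent:
  assumes "0 < x" "0 < y"
  shows "f x + deriv f x * (y - x) \<le> f y"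
proof -
  have "deriv f x * (y - x) \<le> f y - f x"
    by (rule convex_on_imp_above_tangent[OF sh_convex])
      (use assms sh_deriv[of x] in \<open>auto simp: interior_open intro: has_field_derivative_at_within\<close>)
  then show ?thesis by simp
qed

lemma sh_deriv_neg:
  assumes "0 < x" shows "deriv f x < 0"
proof (rule ccontr)
  assume "\<not> deriv f x < 0"
  \<comment> \<open>A tangent at \<open>x\<close> that does not fall would keep \<open>f\<close>
    above the positive value \<open>f x\<close>, against the limit 0.\<close>
  then have "f x \<le> f y" if "x < y" for y
    using sh_tangent[of x y] that assms mult_nonneg_nonneg[of "deriv f x" "y - x"] by linarith
  then have "eventually (\<lambda>y. f x \<le> f y) at_top"
    by (rule eventually_mono[OF eventually_gt_at_top])
  moreover have "eventually (\<lambda>y. f y < f x) at_top"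
    using order_tendstoD(2)[OF sh_tendsto] sh_pos[OF assms] by auto
  ultimately have "eventually (\<lambda>y::real. False) at_top" by eventually_elim auto
  then show False by simp
qed

lemma sh_strict_decreasing:
  assumes "0 < x" "x < y" shows "f y < f x"
  by (rule DERIV_neg_imp_decreasing[OF assms(2)])
    (use assms sh_deriv sh_deriv_neg in \<open>metis less_le_trans\<close>)

lemma sh_continuous: "continuous_on {0<..} f"
  by (rule continuous_at_imp_continuous_on) (use sh_deriv DERIV_isCont in auto)

lemma sh_large:
  assumes "0 < \<delta>" shows "\<exists>u. 0 < u \<and> u < \<delta> \<and> K < f u"
proof -
  have "eventually (\<lambda>u. K < f u) (at_right 0)"
    using sh by (auto simp: strongly_hyperbolic_def filterlim_at_top_dense)
  moreover have "eventually (\<lambda>u. 0 < u \<and> u < \<delta>) (at_right (0::real))"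
    using assms by (auto simp: eventually_at_right_field)
  ultimately have "eventually (\<lambda>u. 0 < u \<and> u < \<delta> \<and> K < f u) (at_right 0)"
    by eventually_elim auto
  then show ?thesis using eventually_happens by fastforce
qed

lemma sh_ex1_value:
  assumes "0 < y" shows "\<exists>!x. 0 < x \<and> f x = y"
proof -
  obtain v where v: "0 < v" "y < f v" using sh_large[of 1 y] by auto
  have "eventually (\<lambda>u. f u < y \<and> 0 < u) at_top"
    using order_tendstoD(2)[OF sh_tendsto assms] eventually_gt_at_top by (rule eventually_conj)
  then obtain u where "f u < y" "0 < u" using eventually_happens by fastforce
  then have "\<exists>!x. x \<in> {0<..} \<and> f x = y"
    by (intro connected_ex1_value_decreasing[where u = u and v = v])
      (use v sh_continuous sh_strict_decreasing in auto)
  then show ?thesis by simp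
qed

lemma sh_deriv_mono:
  assumes "0 < x" "x \<le> y" shows "deriv f x \<le> deriv f y"
proof (cases "x = y")
  case False
  have "deriv f x * (y - x) \<le> deriv f y * (y - x)"
    using sh_tangent[of x y] sh_tangent[of y x] assms by (simp add: algebra_simps)
  then show ?thesis using False assms by simp
qed simp

lemma sh_lnderiv: "strictly_convex_on {0<..} (\<lambda>x. ln \<bar>deriv f x\<bar>)"
  using sh by (simp add: strongly_hyperbolic_def)

lemma sh_deriv_strict_mono:
  assumes "0 < x" "x < y" shows "deriv f x < deriv f y"
proof (rule ccontr)
  assume "\<not> deriv f x < deriv f y"
  then have eq: "deriv f x = deriv f y" using sh_deriv_mono[of x y] assms by simp
  define z where "z = (x + y) / 2"
  have z: "x < z" "z < y" using assms by (auto simp: z_def)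
  have "deriv f z = deriv f x" using eq sh_deriv_mono[of x z] sh_deriv_mono[of z y] z assms by auto
  \<comment> \<open>The points \<open>x\<close>, \<open>z\<close>, \<open>y\<close> are equally
    spaced and carry equal derivatives, which strict convexity forbids at the midpoint.\<close>
  moreover have "ln \<bar>deriv f (x + (z - x))\<bar> + ln \<bar>deriv f z\<bar> < ln \<bar>deriv f x\<bar> + ln \<bar>deriv f (z + (z - x))\<bar>"
    using strictly_convex_crossing[OF sh_lnderiv, of x z "z - x"] z assms by auto
  moreover have "z + (z - x) = y" by (simp add: z_def field_simps)
  ultimately show False using eq by simp
qed

text \<open>A convex function on an open interval is continuous, and \<open>deriv f\<close> is
  recovered from \<open>ln \<bar>deriv f x\<bar>\<close> because its sign is known.\<close>

lemma sh_deriv_continuous: "continuous_on {0<..} (deriv f)"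
proof -
  have "convex_on {0<..} (\<lambda>x. ln \<bar>deriv f x\<bar>)"
    by (rule strictly_convex_imp_convex[OF sh_lnderiv]) auto
  then have "continuous_on {0<..} (\<lambda>x. ln \<bar>deriv f x\<bar>)"
    by (rule convex_on_continuous[rotated]) auto
  then have "continuous_on {0<..} (\<lambda>x. - exp (ln \<bar>deriv f x\<bar>))"
    by (intro continuous_on_minus continuous_on_exp)
  then show ?thesis
    by (rule continuous_on_eq) (use sh_deriv_neg in force)
qed

section \<open>Monotone ratios from logarithmic convexity of the derivative\<close>

lemma sh_deriv_crossing:
  assumes "0 < u" "u < v" "0 < d"
  shows "deriv f (u + d) * deriv f v < deriv f u * deriv f (v + d)"
proof -
  have "ln \<bar>deriv f (u + d)\<bar> + ln \<bar>deriv f v\<bar> < ln \<bar>deriv f u\<bar> + ln \<bar>deriv f (v + d)\<bar>"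
    using strictly_convex_crossing[OF sh_lnderiv, of u v d] assms by simp
  moreover have neg: "deriv f (u + d) < 0" "deriv f v < 0" "deriv f u < 0" "deriv f (v + d) < 0"
    using assms sh_deriv_neg by auto
  ultimately have "ln ((- deriv f (u + d)) * (- deriv f v)) < ln ((- deriv f u) * (- deriv f (v + d)))"
    by (subst (1 2) ln_mult) auto
  then show ?thesis
    by (subst (asm) ln_less_cancel_iff) (auto simp: neg mult_neg_neg)
qed

lemma sh_cauchy_mean:
  assumes "0 < x" "x < y" "0 \<le> d"
  shows "\<exists>\<xi>. x < \<xi> \<and> \<xi> < y \<and>
    (f (x + d) - f (y + d)) * deriv f \<xi> = (f x - f y) * deriv f (\<xi> + d)"
proof -
  have D: "((\<lambda>x. f (x + d)) has_real_derivative deriv f (z + d)) (at z)" if "0 < z" for z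
    using sh_deriv[of "z + d"] that assms by (simp add: DERIV_shift)
  have "\<exists>\<xi>. x < \<xi> \<and> \<xi> < y \<and>
     (f (y + d) - f (x + d)) * deriv f \<xi> = (f y - f x) * deriv f (\<xi> + d)"
  proof (rule GMVT'[OF assms(2)])
    show "isCont (\<lambda>x. f (x + d)) z" if "x \<le> z" "z \<le> y" for z
      by (rule DERIV_isCont[OF D]) (use that assms in auto)
    show "isCont f z" if "x \<le> z" "z \<le> y" for z
      by (rule DERIV_isCont[OF sh_deriv]) (use that assms in auto)
  qed (use assms sh_deriv D in auto)
  then show ?thesis by (auto simp: algebra_simps)
qed

text \<open>Write \<open>R x = deriv f (x + d) / deriv f x\<close>, which increases by
  \<open>sh_deriv_crossing\<close>. The ratio of the drops of \<open>f\<close> over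
  \<open>[x + d, y + d]\<close> and \<open>[x, y]\<close> equals \<open>R \<xi>\<close> for some
  \<xi> in between, so it exceeds \<open>R x\<close>; the companion \<open>sh_shift_upper\<close>
  bounds it by \<open>R y\<close>.\<close>

lemma sh_shift_lower:
  assumes "0 < x" "x < y" "0 < d"
  shows "(f x - f y) * deriv f (x + d) > (f (x + d) - f (y + d)) * deriv f x"
proof -
  obtain \<xi> where \<xi>: "x < \<xi>" "\<xi> < y"
    and eq: "(f (x + d) - f (y + d)) * deriv f \<xi> = (f x - f y) * deriv f (\<xi> + d)"
    using sh_cauchy_mean[of x y d] assms by auto
  have neg: "deriv f x < 0" "deriv f \<xi> < 0" using \<xi> assms sh_deriv_neg by auto
  have "0 < f x - f y" using sh_strict_decreasing assms by simp
  then have "(f x - f y) * (deriv f (x + d) * deriv f \<xi>) < (f x - f y) * (deriv f x * deriv f (\<xi> + d))"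
    using sh_deriv_crossing[of x \<xi> d] \<xi> assms by simp
  also have "\<dots> = ((f x - f y) * deriv f (\<xi> + d)) * deriv f x" by simp
  also have "\<dots> = ((f (x + d) - f (y + d)) * deriv f x) * deriv f \<xi>"
    unfolding eq[symmetric] by simp
  finally have "((f x - f y) * deriv f (x + d)) * deriv f \<xi> < ((f (x + d) - f (y + d)) * deriv f x) * deriv f \<xi>"
    by (simp add: mult.assoc)
  then show ?thesis using neg by (simp add: mult_less_cancel_right)
qed

lemma sh_shift_upper:
  assumes "0 < x" "x < y" "0 < d"
  shows "(f (x + d) - f (y + d)) * deriv f y > (f x - f y) * deriv f (y + d)"
proof -
  obtain \<xi> where \<xi>: "x < \<xi>" "\<xi> < y"
    and eq: "(f (x + d) - f (y + d)) * deriv f \<xi> = (f x - f y) * deriv f (\<xi> + d)"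
    using sh_cauchy_mean[of x y d] assms by auto
  have neg: "deriv f y < 0" "deriv f \<xi> < 0" using \<xi> assms sh_deriv_neg by auto
  have "0 < f x - f y" using sh_strict_decreasing assms by simp
  then have "(f x - f y) * (deriv f (\<xi> + d) * deriv f y) < (f x - f y) * (deriv f \<xi> * deriv f (y + d))"
    using sh_deriv_crossing[of \<xi> y d] \<xi> assms by simp
  also have "\<dots> = ((f x - f y) * deriv f (y + d)) * deriv f \<xi>" by simp
  finally have "((f x - f y) * deriv f (\<xi> + d)) * deriv f y < \<dots>" by (simp only: mult.assoc)
  then have "((f (x + d) - f (y + d)) * deriv f y) * deriv f \<xi> < ((f x - f y) * deriv f (y + d)) * deriv f \<xi>"
    unfolding eq[symmetric] by (simp only: mult_ac)
  then show ?thesis using neg by (simp add: mult_less_cancel_right)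
qed

text \<open>The number \<open>deriv f (y + d) / deriv f y\<close> separates the two ratios of drops:
  it is an upper bound over \<open>[x, y]\<close> and a lower bound over
  \<open>[y, z]\<close>.\<close>

lemma sh_chords:
  assumes "0 < x" "x < y" "y < z" "0 < d"
  shows "(f (x + d) - f (y + d)) * (f y - f z) < (f x - f y) * (f (y + d) - f (z + d))"
proof -
  define A B A' B' where defs: "A = f x - f y" "B = f y - f z" "A' = f (x + d) - f (y + d)" "B' = f (y + d) - f (z + d)"
  have pos: "0 < A" "0 < B" "0 < A'" "0 < B'"
    using sh_strict_decreasing assms by (auto simp: defs)
  define h k where hk: "h = - deriv f y" "k = - deriv f (y + d)"
  have hk0: "0 < h" "0 < k" using sh_deriv_neg assms by (auto simp: hk)
  have 1: "A' * h < A * k" using sh_shift_upper[of x y d] assms by (simp add: defs hk)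
  have 2: "B * k < B' * h" using sh_shift_lower[of y z d] assms by (simp add: defs hk)
  have "(A' * h) * (B * k) < (A * k) * (B' * h)"
    by (rule mult_strict_mono[OF 1 2]) (use pos hk0 in auto)
  then have "(A' * B) * (h * k) < (A * B') * (h * k)" by (simp add: mult_ac)
  then show ?thesis using hk0 by (simp add: defs mult_less_cancel_right)
qed

text \<open>The far end of the chord in \<open>sh_shift_lower\<close> goes to infinity, where
  \<open>f\<close> vanishes; only the weak inequality survives the limit.\<close>

lemma sh_tail:
  assumes "0 < y" "0 < d"
  shows "f y * deriv f (y + d) \<ge> f (y + d) * deriv f y"
proof -
  have "((\<lambda>z. (f y - f z) * deriv f (y + d)) \<longlongrightarrow> (f y - 0) * deriv f (y + d)) at_top"
    by (intro tendsto_intros sh_tendsto)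
  moreover have "((\<lambda>z. f (z + d)) \<longlongrightarrow> 0) at_top"
    by (rule filterlim_compose[OF sh_tendsto]) (simp add: add.commute[of _ d] filterlim_tendsto_add_at_top[OF tendsto_const] filterlim_ident)
  then have "((\<lambda>z. (f (y + d) - f (z + d)) * deriv f y) \<longlongrightarrow> (f (y + d) - 0) * deriv f y) at_top"
    by (intro tendsto_intros)
  moreover have "eventually (\<lambda>z. (f (y + d) - f (z + d)) * deriv f y \<le> (f y - f z) * deriv f (y + d)) at_top"
    using eventually_gt_at_top[of y]
    by eventually_elim (use sh_shift_lower[of y] assms in \<open>auto intro: less_imp_le\<close>)
  ultimately show ?thesis
    using tendsto_le[OF trivial_limit_at_top_linorder] by fastforce
qed

text \<open>Strictness is recovered by splitting off a segment of length 1: the bound for its chord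
  is strict, and \<open>sh_deriv_crossing\<close> sharpens the weak bound for the tail beyond
  \<open>x + 1\<close>.\<close>

lemma sh_tail_strict:
  assumes "0 < x" "0 < d"
  shows "f x * deriv f (x + d) > f (x + d) * deriv f x"
proof -
  have 1: "(f x - f (x + 1)) * deriv f (x + d) > (f (x + d) - f (x + 1 + d)) * deriv f x"
    by (rule sh_shift_lower) (use assms in auto)
  have 2: "f (x + 1) * deriv f (x + 1 + d) \<ge> f (x + 1 + d) * deriv f (x + 1)"
    by (rule sh_tail) (use assms in auto)
  have 3: "deriv f (x + d) * deriv f (x + 1) < deriv f x * deriv f (x + 1 + d)"
    by (rule sh_deriv_crossing) (use assms in auto)
  define p q r s where pqrs: "p = - deriv f x" "q = - deriv f (x + d)" "r = - deriv f (x + 1)" "s = - deriv f (x + 1 + d)"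
  have pos: "0 < p" "0 < q" "0 < r" "0 < s" using assms sh_deriv_neg by (auto simp: pqrs)
  have f0: "0 < f (x + 1)" "0 < f (x + 1 + d)" using assms sh_pos by auto
  have "f (x + 1) * s \<le> f (x + 1 + d) * r" "q * r < p * s" using 2 3 by (auto simp: pqrs)
  then have "(f (x + 1) * s) * (q * r) < (f (x + 1 + d) * r) * (p * s)"
    by (rule mult_le_less_imp_less) (use pos f0 in auto)
  then have "(f (x + 1) * q) * (r * s) < (f (x + 1 + d) * p) * (r * s)" by (simp add: mult_ac)
  then have "f (x + 1) * q < f (x + 1 + d) * p" using pos by (simp add: mult_less_cancel_right)
  then show ?thesis using 1 by (simp add: pqrs algebra_simps)
qed

text \<open>Strict logarithmic convexity passes from the derivative to \<open>f\<close>. The value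
  \<open>f u\<close> is the drop over \<open>[u, v]\<close> plus the tail \<open>f v\<close>, and
  \<open>deriv f (v + d) / deriv f v\<close> bounds the ratio of the drops strictly from above and
  the ratio of the tails from below.\<close>

lemma sh_log_convex:
  assumes "0 < u" "u < v" "0 < d"
  shows "f (u + d) * f v < f (v + d) * f u"
proof -
  have 1: "(f (u + d) - f (v + d)) * deriv f v > (f u - f v) * deriv f (v + d)"
    by (rule sh_shift_upper) (use assms in auto)
  have 2: "f v * deriv f (v + d) \<ge> f (v + d) * deriv f v"
    by (rule sh_tail) (use assms in auto)
  define p q where pq: "p = - deriv f v" "q = - deriv f (v + d)"
  have pos: "0 < p" "0 < q" using assms sh_deriv_neg by (auto simp: pq)
  have f0: "0 < f v" "0 < f (v + d)" "f v < f u" using assms sh_pos sh_strict_decreasing by auto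
  have "(f (u + d) - f (v + d)) * p < (f u - f v) * q" using 1 by (simp add: pq)
  then have "f v * ((f (u + d) - f (v + d)) * p) < f v * ((f u - f v) * q)" using f0 by simp
  also have "\<dots> = (f u - f v) * (f v * q)" by simp
  also have "\<dots> \<le> (f u - f v) * (f (v + d) * p)"
    using 2 f0 by (intro mult_left_mono) (auto simp: pq)
  finally have "(f v * (f (u + d) - f (v + d))) * p < ((f u - f v) * f (v + d)) * p" by (simp add: mult_ac)
  then have "f v * (f (u + d) - f (v + d)) < (f u - f v) * f (v + d)"
    using pos by (simp add: mult_less_cancel_right)
  then show ?thesis by (simp add: algebra_simps)
qed

section \<open>Behaviour near zero and at infinity\<close>

lemma sh_chord_bounds:
  assumes "0 < x" "0 < d"
  shows "- d * deriv f (x + d) \<le> f x - f (x + d)" "f x - f (x + d) \<le> - d * deriv f x"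
  using sh_tangent[of x "x + d"] sh_tangent[of "x + d" x] assms by (auto simp: algebra_simps)

lemma sh_ratio_tail:
  assumes "1 < k" shows "eventually (\<lambda>x. f x < k * f (x + d)) at_top"
proof -
  have "((\<lambda>x. f (x + d) / f x) \<longlongrightarrow> 1) at_top"
    using sh by (simp add: strongly_hyperbolic_def)
  then have "eventually (\<lambda>x. 1 / k < f (x + d) / f x) at_top"
    by (rule order_tendstoD(1)) (use assms in auto)
  then show ?thesis using eventually_gt_at_top[of 0]
    by eventually_elim (use sh_pos assms in \<open>auto simp: field_simps\<close>)
qed

text \<open>Transfers the limit law from \<open>f\<close> to its derivative. A single
  \<open>x\<close> is enough, since it only has to serve as a witness on one side of a target
  value.\<close>

lemma sh_deriv_ratio_tail:
  assumes "1 < k" "0 < d"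
  shows "\<exists>x>0. - deriv f x < - k * deriv f (x + d)"
proof (rule ccontr)
  assume "\<not> ?thesis"
  then have le: "k * deriv f (x + d) \<ge> deriv f x" if "0 < x" for x using that by force
  \<comment> \<open>Under the contrary assumption \<open>k * f (z + d) - f z\<close> is
    nondecreasing in \<open>z\<close> and tends to 0, hence it is never positive.\<close>
  have bound: "k * f (x + d) \<le> f x" if x: "0 < x" for x
  proof -
    have ev: "k * f (x + d) - f x \<le> k * f (y + d) - f y" if y: "x < y" for y
    proof (rule DERIV_nonneg_imp_nondecreasing[of x y "\<lambda>z. k * f (z + d) - f z"])
      fix z assume z: "x \<le> z" "z \<le> y"
      have "((\<lambda>z. k * f (z + d) - f z) has_real_derivative (k * deriv f (z + d) - deriv f z)) (at z)"
        using sh_deriv[of "z + d"] sh_deriv[of z] z x assms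
        by (intro DERIV_diff DERIV_cmult) (auto simp: DERIV_shift)
      then show "\<exists>D. ((\<lambda>z. k * f (z + d) - f z) has_real_derivative D) (at z) \<and> 0 \<le> D"
        using le[of z] z x by auto
    qed (use y in auto)
    have "((\<lambda>z. f (z + d)) \<longlongrightarrow> 0) at_top"
      by (rule filterlim_compose[OF sh_tendsto]) (simp add: add.commute[of _ d] filterlim_tendsto_add_at_top[OF tendsto_const] filterlim_ident)
    then have "((\<lambda>y. k * f (y + d) - f y) \<longlongrightarrow> k * 0 - 0) at_top"
      by (intro tendsto_intros sh_tendsto)
    moreover have "eventually (\<lambda>y. k * f (x + d) - f x \<le> k * f (y + d) - f y) at_top"
      using eventually_gt_at_top[of x] by eventually_elim (rule ev)
    ultimately have "k * f (x + d) - f x \<le> k * 0 - 0"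
      by (intro tendsto_lowerbound) auto
    then show ?thesis by simp
  qed
  have "eventually (\<lambda>x. f x < k * f (x + d) \<and> 0 < x) at_top"
    using sh_ratio_tail[OF assms(1)] eventually_gt_at_top by (rule eventually_conj)
  then obtain x where "f x < k * f (x + d)" "0 < x" using eventually_happens by fastforce
  then show False using bound[of x] by simp
qed

lemma sh_steep_near_zero:
  assumes "0 < r" "0 < \<delta>"
  shows "\<exists>u. 0 < u \<and> u < \<delta> \<and> r * f u < - deriv f u \<and> K < - deriv f u"
proof -
  \<comment> \<open>Once \<open>2 * f y < f u\<close>, the tangent at \<open>u\<close> must drop by
    more than \<open>f u / 2\<close> before \<open>y\<close>; with this \<open>y\<close> that says
    \<open>r * f u < - deriv f u\<close>. The extra bound \<open>\<bar>K\<bar> / r < f u\<close>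
    then makes the slope exceed \<open>K\<close>.\<close>
  define y where "y = 1 / (2 * r)"
  have y: "0 < y" using assms by (simp add: y_def)
  obtain u where u: "0 < u" "u < min \<delta> y" "max (2 * f y) (\<bar>K\<bar> / r) < f u"
    using sh_large[of "min \<delta> y" "max (2 * f y) (\<bar>K\<bar> / r)"] assms y by auto
  have "f u + deriv f u * (y - u) \<le> f y" using sh_tangent[of u y] u y by simp
  then have "f u / 2 < - deriv f u * (y - u)" using u by (simp add: algebra_simps)
  also have "\<dots> < - deriv f u * y" using sh_deriv_neg[of u] u by (simp add: right_diff_distrib mult_neg_pos)
  finally have 1: "r * f u < - deriv f u" using assms by (simp add: y_def field_simps)
  have "\<bar>K\<bar> < r * f u" using u assms by (simp add: field_simps)
  then show ?thesis using 1 u by (intro exI[of _ u]) auto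
qed

text \<open>The slope at the right end of a unit chord is at most the drop over it, and the limit
  law makes that drop small compared with \<open>f (x + 1)\<close>.\<close>

lemma sh_flat_at_top:
  assumes "0 < r" shows "\<exists>u>0. - deriv f u < r * f u"
proof -
  have "eventually (\<lambda>x. f x < (1 + r) * f (x + 1) \<and> 0 < x) at_top"
    by (intro eventually_conj sh_ratio_tail eventually_gt_at_top) (use assms in auto)
  then obtain x where "f x < (1 + r) * f (x + 1)" "0 < x" using eventually_happens by fastforce
  then show ?thesis using sh_chord_bounds(1)[of x 1] by (intro exI[of _ "x + 1"]) (auto simp: algebra_simps)
qed

lemma sh_tangent_strict:
  assumes "0 < x" "0 < y" "x \<noteq> y"
  shows "f x + deriv f x * (y - x) < f y"
proof -
  define z where "z = (x + y) / 2"
  have z: "0 < z" "y - z = (y - x) / 2" "z - x = (y - x) / 2" "x < y \<Longrightarrow> x < z" "y < x \<Longrightarrow> z < x"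
    using assms by (auto simp: z_def field_simps)
  have "f x + deriv f x * ((y - x) / 2) \<le> f z" "f z + deriv f z * ((y - x) / 2) \<le> f y"
    using sh_tangent[of x z] sh_tangent[of z y] z assms by auto
  moreover have "deriv f x * ((y - x) / 2) < deriv f z * ((y - x) / 2)"
    using sh_deriv_strict_mono[of x z] sh_deriv_strict_mono[of z x] z assms
    by (cases "x < y") (auto simp: mult_less_cancel_right)
  ultimately show ?thesis by (simp add: field_simps)
qed

lemma sh_chord_slopes:
  assumes "0 < u" "u < v" "v < w"
  shows "(f v - f w) * (v - u) < (f u - f v) * (w - v)"
proof -
  have "f v - f w < - deriv f v * (w - v)" "- deriv f v * (v - u) < f u - f v"
    using sh_tangent_strict[of v w] sh_tangent_strict[of v u] assms by (auto simp: algebra_simps)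
  then have "(f v - f w) * (v - u) < (- deriv f v * (w - v)) * (v - u)"
    "(- deriv f v * (v - u)) * (w - v) < (f u - f v) * (w - v)"
    using assms by (simp_all only: mult_less_cancel_right_pos diff_gt_0_iff_gt)
  then show ?thesis by (simp add: mult_ac)
qed

end

section \<open>Uniquely solvable equations for the distance from the pole\<close>

lemma sh_continuous_comp:
  assumes "strongly_hyperbolic f" "continuous_on A k" "\<And>x. x \<in> A \<Longrightarrow> 0 < k x"
  shows "continuous_on A (\<lambda>x. f (k x))" "continuous_on A (\<lambda>x. deriv f (k x))"
  using continuous_on_compose2[OF sh_continuous[OF assms(1)] assms(2)]
    continuous_on_compose2[OF sh_deriv_continuous[OF assms(1)] assms(2)] assms(3) by auto

text \<open>Two points on one branch with known asymptote. By logarithmic convexity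
  \<open>f u / f (u + d)\<close> decreases, from infinity at 0 towards 1, hence the condition
  \<open>1 < r\<close>. The same equation later decides whether two circles with a common asymptote
  meet.\<close>

lemma sh_ex1_ratio_shift:
  assumes f: "strongly_hyperbolic f" and "1 < r" "0 < d"
  shows "\<exists>!u. 0 < u \<and> f u = r * f (u + d)"
proof -
  note pos = sh_pos[OF f] and dec = sh_strict_decreasing[OF f]
  have "eventually (\<lambda>u. f u < r * f (u + d) \<and> 0 < u) at_top"
    by (rule eventually_conj[OF sh_ratio_tail[OF f assms(2)] eventually_gt_at_top])
  then obtain u where u: "0 < u" "f u < r * f (u + d)"
    using eventually_happens'[OF trivial_limit_at_top_linorder] by blast
  obtain v where v: "0 < v" "v < 1" "r * f d < f v" using sh_large[OF f, of 1 "r * f d"] by auto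
  have "r * f (v + d) < r * f d" using dec[of d "v + d"] assms v by simp
  then have v': "r * f (v + d) < f v" using v by simp
  have "\<exists>!u. u \<in> {0<..} \<and> f u / f (u + d) = r"
  proof (rule connected_ex1_value_decreasing[where u = u and v = v])
    show "f t / f (t + d) < f s / f (s + d)" if "s \<in> {0<..}" "t \<in> {0<..}" "s < t" for s t
      using sh_log_convex[OF f, of s t d] pos[of "s + d"] pos[of "t + d"] that assms
      by (simp add: field_simps)
    have "f (x + d) \<noteq> 0" if "0 < x" for x using pos[of "x + d"] that assms by auto
    then show "continuous_on {0<..} (\<lambda>u. f u / f (u + d))"
      using assms by (intro continuous_intros sh_continuous_comp[OF f]) auto
  qed (use u v v' pos assms in \<open>auto simp: field_simps\<close>)
  moreover have "f u / f (u + d) = r \<longleftrightarrow> f u = r * f (u + d)" if "0 < u" for u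
    using pos[of "u + d"] that assms by (simp add: field_simps)
  ultimately show ?thesis by (metis greaterThan_iff)
qed

text \<open>Two points at horizontal distance \<open>D\<close>, on opposite branches with known
  asymptote. As the pole moves between them one value falls and the other rises, and each blows up
  at one end, so monotonicity of \<open>f\<close> and \<open>g\<close> suffices.\<close>

lemma sh_ex1_ratio_opposite:
  assumes f: "strongly_hyperbolic f" and g: "strongly_hyperbolic g" and "0 < r" "0 < D"
  shows "\<exists>!u. 0 < u \<and> u < D \<and> f u = r * g (D - u)"
proof -
  note pos = sh_pos[OF f] sh_pos[OF g] and dec = sh_strict_decreasing[OF f] sh_strict_decreasing[OF g]
  obtain v where v: "0 < v" "v < D / 2" "r * g (D / 2) < f v"
    using sh_large[OF f, of "D / 2" "r * g (D / 2)"] assms by auto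
  have "r * g (D - v) < r * g (D / 2)" using dec(2)[of "D / 2" "D - v"] v assms by simp
  then have v': "r * g (D - v) < f v" using v by simp
  obtain w where w: "0 < w" "w < D / 2" "f (D / 2) / r < g w"
    using sh_large[OF g, of "D / 2" "f (D / 2) / r"] assms by auto
  have "f (D - w) < r * g w" using dec(1)[of "D / 2" "D - w"] w assms by (simp add: field_simps)
  then have w': "f (D - w) < r * g (D - (D - w))" by simp
  have "\<exists>!u. u \<in> {0<..<D} \<and> f u / g (D - u) = r"
  proof (rule connected_ex1_value_decreasing[where u = "D - w" and v = v])
    show "f t / g (D - t) < f s / g (D - s)" if "s \<in> {0<..<D}" "t \<in> {0<..<D}" "s < t" for s t
      using dec(1)[of s t] dec(2)[of "D - t" "D - s"] pos(1)[of t] pos(2)[of "D - s"] that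
      by (intro frac_less) auto
    have "g (D - x) \<noteq> 0" if "x < D" for x using pos(2)[of "D - x"] that by auto
    then show "continuous_on {0<..<D} (\<lambda>u. f u / g (D - u))"
      using assms by (intro continuous_intros sh_continuous_comp[OF f] sh_continuous_comp[OF g]) auto
  qed (use v w v' w' pos assms in \<open>auto simp: pos_divide_less_eq pos_less_divide_eq\<close>)
  moreover have "f u / g (D - u) = r \<longleftrightarrow> f u = r * g (D - u)" if "u < D" for u
    using pos(2)[of "D - u"] that by (simp add: field_simps)
  ultimately show ?thesis by (metis greaterThanLessThan_iff)
qed

text \<open>Three points on one branch. The ratio of consecutive drops decreases by
  \<open>sh_chords\<close>; it is unbounded near 0, and its infimum is the value
  \<open>d / (e - d)\<close> that a straight line would give, hence the lower bound on
  \<open>r\<close>.\<close>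

lemma sh_ex1_chord_ratio:
  assumes f: "strongly_hyperbolic f" and "0 < d" "d < e" "d / (e - d) < r"
  shows "\<exists>!u. 0 < u \<and> f u - f (u + d) = r * (f (u + d) - f (u + e))"
proof -
  note pos = sh_pos[OF f] and dec = sh_strict_decreasing[OF f]
  have r0: "0 < r" using assms divide_pos_pos[of d "e - d"] by linarith
  obtain v where v: "0 < v" "v < 1" "(1 + r) * f d < f v"
    using sh_large[OF f, of 1 "(1 + r) * f d"] by auto
  have "(1 + r) * f (v + d) < (1 + r) * f d" using dec[of d "v + d"] assms v r0 by simp
  moreover have "0 < r * f (v + e)" using pos v assms r0 by simp
  ultimately have v': "r * (f (v + d) - f (v + e)) < f v - f (v + d)" using v by (simp add: algebra_simps)
  \<comment> \<open>Chosen so that \<open>d * k = r * (e - d)\<close>, which lets the upper bound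
    for the first drop meet the lower bound for the second.\<close>
  define k where "k = r * (e - d) / d"
  have "1 < k" using assms by (simp add: k_def field_simps)
  then obtain u where u: "0 < u" "- deriv f u < - k * deriv f (u + e)"
    using sh_deriv_ratio_tail[OF f, of k e] assms by auto
  have "f u - f (u + d) \<le> d * (- deriv f u)" using sh_chord_bounds(2)[OF f, of u d] u assms by simp
  also have "\<dots> < d * (- k * deriv f (u + e))" using u assms by simp
  also have "\<dots> = r * (- (e - d) * deriv f (u + d + (e - d)))" 
    using assms by (simp add: k_def) (simp add: algebra_simps)
  also have "\<dots> \<le> r * (f (u + d) - f (u + d + (e - d)))"
    using sh_chord_bounds(1)[OF f, of "u + d" "e - d"] u assms r0 by simp
  finally have u': "f u - f (u + d) < r * (f (u + d) - f (u + e))" by simp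
  have den: "0 < f (x + d) - f (x + e)" if "0 < x" for x using dec[of "x + d" "x + e"] that assms by simp
  have "\<exists>!u. u \<in> {0<..} \<and> (f u - f (u + d)) / (f (u + d) - f (u + e)) = r"
  proof (rule connected_ex1_value_decreasing[where u = u and v = v])
    show "(f t - f (t + d)) / (f (t + d) - f (t + e)) < (f s - f (s + d)) / (f (s + d) - f (s + e))"
      if "s \<in> {0<..}" "t \<in> {0<..}" "s < t" for s t
    proof -
      have eq: "s + d + (t - s) = t + d" "s + e + (t - s) = t + e" "s + (t - s) = t" by auto
      have "(f t - f (t + d)) * (f (s + d) - f (s + e)) < (f s - f (s + d)) * (f (t + d) - f (t + e))"
        using sh_chords[OF f, of s "s + d" "s + e" "t - s"] that assms unfolding eq by simp
      then show ?thesis using den[of s] den[of t] that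
        by (simp add: pos_divide_less_eq pos_less_divide_eq)
    qed
    have "f (x + d) - f (x + e) \<noteq> 0" if "0 < x" for x using den[of x] that by auto
    then show "continuous_on {0<..} (\<lambda>u. (f u - f (u + d)) / (f (u + d) - f (u + e)))"
      using assms by (intro continuous_intros sh_continuous_comp[OF f]) auto
    show "(f u - f (u + d)) / (f (u + d) - f (u + e)) < r" "r < (f v - f (v + d)) / (f (v + d) - f (v + e))"
      using u' v' den[of u] den[of v] u v by (simp_all add: pos_divide_less_eq pos_less_divide_eq)
  qed (use u v in auto)
  moreover have "(f u - f (u + d)) / (f (u + d) - f (u + e)) = r
      \<longleftrightarrow> f u - f (u + d) = r * (f (u + d) - f (u + e))" if "0 < u" for u
    using den[of u] that by (simp add: divide_eq_eq)
  ultimately show ?thesis by (metis greaterThan_iff)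
qed

text \<open>Two points on the branch of \<open>f\<close>, one on that of \<open>g\<close>. The
  quotient is split into two increasing terms: \<open>f (u + d)\<close> over the drop grows by
  logarithmic convexity, \<open>g (D - u)\<close> over the drop because the numerator grows while
  the drop shrinks.\<close>

lemma sh_ex1_gap_ratio:
  assumes f: "strongly_hyperbolic f" and g: "strongly_hyperbolic g" and "0 < r" "0 < d" "0 < D"
  shows "\<exists>!u. 0 < u \<and> u < D \<and> f (u + d) + g (D - u) = r * (f u - f (u + d))"
proof -
  note pos = sh_pos[OF f] sh_pos[OF g] and dec = sh_strict_decreasing[OF f] sh_strict_decreasing[OF g]
  obtain v where v: "0 < v" "v < D / 2" "((1 + r) * f d + g (D / 2)) / r < f v"
    using sh_large[OF f, of "D / 2" "((1 + r) * f d + g (D / 2)) / r"] assms by auto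
  have "(1 + r) * f (v + d) < (1 + r) * f d" using dec(1)[of d "v + d"] v assms by simp
  moreover have "g (D - v) < g (D / 2)" using dec(2)[of "D / 2" "D - v"] v assms by simp
  ultimately have v': "f (v + d) + g (D - v) < r * (f v - f (v + d))"
    using v assms by (simp add: field_simps)
  obtain w where w: "0 < w" "w < D / 2" "r * f (D / 2) < g w"
    using sh_large[OF g, of "D / 2" "r * f (D / 2)"] assms by auto
  have "r * f (D - w) < r * f (D / 2)" using dec(1)[of "D / 2" "D - w"] w assms by simp
  moreover have "0 < (1 + r) * f (D - w + d)" using pos(1)[of "D - w + d"] w assms by simp
  ultimately have w': "r * (f (D - w) - f (D - w + d)) < f (D - w + d) + g (D - (D - w))"
    using w by (simp add: algebra_simps)
  have den: "0 < f x - f (x + d)" if "0 < x" for x using dec(1)[of x "x + d"] that assms by simp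
  have "\<exists>!u. u \<in> {0<..<D} \<and> (f (u + d) + g (D - u)) / (f u - f (u + d)) = r"
  proof (rule connected_ex1_value_increasing[where u = v and v = "D - w"])
    show "(f (s + d) + g (D - s)) / (f s - f (s + d)) < (f (t + d) + g (D - t)) / (f t - f (t + d))"
      if st: "s \<in> {0<..<D}" "t \<in> {0<..<D}" "s < t" for s t
    proof -
      have eq: "s + (t - s) = t" "s + d + (t - s) = t + d" by auto
      have lc: "f t * f (s + d) < f (t + d) * f s"
        using sh_log_convex[OF f, of s "s + d" "t - s"] st assms unfolding eq by simp
      have "f (s + d) * (f t - f (t + d)) < f (t + d) * (f s - f (s + d))"
        using lc by (simp add: algebra_simps)
      then have 1: "f (s + d) / (f s - f (s + d)) < f (t + d) / (f t - f (t + d))"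
        using den[of s] den[of t] st by (simp add: pos_divide_less_eq pos_less_divide_eq)
      \<comment> \<open>This too is read off from logarithmic convexity, after multiplication by
        \<open>f (t + d)\<close>.\<close>
      have "f t - f (t + d) < f s - f (s + d)"
      proof -
        have "f (t + d) * (f t - f (t + d)) < f (t + d) * (f s - f (s + d))"
        proof -
          have "f (t + d) * (f t - f (t + d)) < f (s + d) * (f t - f (t + d))"
            using dec(1)[of "s + d" "t + d"] den[of t] st assms by simp
          then show ?thesis using lc by (simp add: algebra_simps)
        qed
        then show ?thesis using pos(1)[of "t + d"] st assms by simp
      qed
      then have 2: "g (D - s) / (f s - f (s + d)) < g (D - t) / (f t - f (t + d))"
        using dec(2)[of "D - t" "D - s"] pos(2)[of "D - s"] den[of t] st
        by (intro frac_less) auto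
      show ?thesis using 1 2 by (simp add: add_divide_distrib)
    qed
    have "f x - f (x + d) \<noteq> 0" if "0 < x" for x using den[of x] that by auto
    then show "continuous_on {0<..<D} (\<lambda>u. (f (u + d) + g (D - u)) / (f u - f (u + d)))"
      using assms by (intro continuous_intros sh_continuous_comp[OF f] sh_continuous_comp[OF g]) auto
    show "(f (v + d) + g (D - v)) / (f v - f (v + d)) < r"
      using v' den[of v] v by (simp add: pos_divide_less_eq)
    show "r < (f (D - w + d) + g (D - (D - w))) / (f (D - w) - f (D - w + d))"
      using w' den[of "D - w"] w by (simp add: pos_less_divide_eq)
  qed (use v w assms in auto)
  moreover have "(f (u + d) + g (D - u)) / (f u - f (u + d)) = r
      \<longleftrightarrow> f (u + d) + g (D - u) = r * (f u - f (u + d))" if "0 < u" for u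
    using den[of u] that by (simp add: divide_eq_eq)
  ultimately show ?thesis by (metis greaterThanLessThan_iff)
qed

text \<open>A prescribed slope at a point of known height over the asymptote fixes the logarithmic
  derivative, which decreases by \<open>sh_tail_strict\<close> and takes arbitrarily large and
  arbitrarily small values.\<close>

lemma sh_ex1_log_deriv:
  assumes f: "strongly_hyperbolic f" and "0 < r"
  shows "\<exists>!u. 0 < u \<and> - deriv f u = r * f u"
proof -
  note pos = sh_pos[OF f]
  obtain v where v: "0 < v" "r * f v < - deriv f v" using sh_steep_near_zero[OF f, of r 1] assms by auto
  obtain u where u: "0 < u" "- deriv f u < r * f u" using sh_flat_at_top[OF f] assms by auto
  have "\<exists>!u. u \<in> {0<..} \<and> - deriv f u / f u = r"
  proof (rule connected_ex1_value_decreasing[where u = u and v = v])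
    show "- deriv f t / f t < - deriv f s / f s" if "s \<in> {0<..}" "t \<in> {0<..}" "s < t" for s t
      using sh_tail_strict[OF f, of s "t - s"] pos[of s] pos[of t] that by (simp add: field_simps)
    have "f x \<noteq> 0" if "0 < x" for x using pos[of x] that by auto
    then show "continuous_on {0<..} (\<lambda>u. - deriv f u / f u)"
      by (intro continuous_intros sh_continuous_comp[OF f]) auto
    show "- deriv f u / f u < r" "r < - deriv f v / f v"
      using u v pos[of u] pos[of v] by (simp_all only: pos_divide_less_eq pos_less_divide_eq)
  qed (use u v in auto)
  moreover have "- deriv f u / f u = r \<longleftrightarrow> - deriv f u = r * f u" if "0 < u" for u
    using pos[of u] that by (subst divide_eq_eq) auto
  ultimately show ?thesis by (metis greaterThan_iff)
qed

text \<open>The slope is prescribed at the end nearer to the pole. The drop divided by that slope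
  increases from near 0 to near \<open>d\<close>, the value for a straight line, hence
  \<open>r < d\<close>.\<close>

lemma sh_ex1_chord_left_slope:
  assumes f: "strongly_hyperbolic f" and "0 < r" "r < d"
  shows "\<exists>!u. 0 < u \<and> f u - f (u + d) = r * (- deriv f u)"
proof -
  note pos = sh_pos[OF f] and neg = sh_deriv_neg[OF f]
  obtain v where v: "0 < v" "1 / r * f v < - deriv f v" using sh_steep_near_zero[OF f, of "1 / r" 1] assms by auto
  have "0 < f (v + d)" using pos v assms by simp
  then have v': "f v - f (v + d) < r * (- deriv f v)" using v assms by (simp add: field_simps)
  obtain u where u: "0 < u" "- deriv f u < - (d / r) * deriv f (u + d)"
    using sh_deriv_ratio_tail[OF f, of "d / r" d] assms by auto
  have "r * (- deriv f u) < - d * deriv f (u + d)" using u assms by (simp add: field_simps)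
  also have "\<dots> \<le> f u - f (u + d)" using sh_chord_bounds(1)[OF f, of u d] u assms by simp
  finally have u': "r * (- deriv f u) < f u - f (u + d)" .
  have "\<exists>!u. u \<in> {0<..} \<and> (f u - f (u + d)) / (- deriv f u) = r"
  proof (rule connected_ex1_value_increasing[where u = v and v = u])
    show "(f s - f (s + d)) / (- deriv f s) < (f t - f (t + d)) / (- deriv f t)"
      if "s \<in> {0<..}" "t \<in> {0<..}" "s < t" for s t
    proof -
      have eq: "s + (t - s) = t" "s + d + (t - s) = t + d" by auto
      have "(f t - f (t + d)) * deriv f s < (f s - f (s + d)) * deriv f t"
        using sh_shift_lower[OF f, of s "s + d" "t - s"] that assms unfolding eq by simp
      then show ?thesis using neg[of s] neg[of t] that by (simp add: field_simps)
    qed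
    have "- deriv f x \<noteq> 0" if "0 < x" for x using neg[of x] that by auto
    then show "continuous_on {0<..} (\<lambda>u. (f u - f (u + d)) / (- deriv f u))"
      using assms by (intro continuous_intros sh_continuous_comp[OF f]) auto
    show "(f v - f (v + d)) / (- deriv f v) < r" "r < (f u - f (u + d)) / (- deriv f u)"
      using u' v' neg[of u] neg[of v] u v by (simp_all only: pos_divide_less_eq pos_less_divide_eq neg_0_less_iff_less)
  qed (use u v in auto)
  moreover have "(f u - f (u + d)) / (- deriv f u) = r \<longleftrightarrow> f u - f (u + d) = r * (- deriv f u)" if "0 < u" for u
    using neg[of u] that by (subst divide_eq_eq) auto
  ultimately show ?thesis by (metis greaterThan_iff)
qed

text \<open>With the slope prescribed at the end farther from the pole the quotient decreases, from
  infinity towards \<open>d\<close>, and the condition turns into \<open>d < r\<close>.\<close>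

lemma sh_ex1_chord_right_slope:
  assumes f: "strongly_hyperbolic f" and "0 < d" "d < r"
  shows "\<exists>!u. 0 < u \<and> f u - f (u + d) = r * (- deriv f (u + d))"
proof -
  note neg = sh_deriv_neg[OF f] and dec = sh_strict_decreasing[OF f]
  obtain v where v: "0 < v" "f d + r * (- deriv f d) < f v" using sh_large[OF f, of 1] by auto
  have "f (v + d) < f d" using dec[of d "v + d"] v assms by simp
  moreover have "r * (- deriv f (v + d)) \<le> r * (- deriv f d)"
    using sh_deriv_mono[OF f, of d "v + d"] v assms by simp
  ultimately have v': "r * (- deriv f (v + d)) < f v - f (v + d)" using v by simp
  obtain u where u: "0 < u" "- deriv f u < - (r / d) * deriv f (u + d)"
    using sh_deriv_ratio_tail[OF f, of "r / d" d] assms by auto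
  have "f u - f (u + d) \<le> - d * deriv f u" using sh_chord_bounds(2)[OF f, of u d] u assms by simp
  also have "\<dots> < r * (- deriv f (u + d))" using u assms by (simp add: field_simps)
  finally have u': "f u - f (u + d) < r * (- deriv f (u + d))" .
  have neg': "0 < - deriv f (x + d)" if "0 < x" for x using neg[of "x + d"] that assms by simp
  have "\<exists>!u. u \<in> {0<..} \<and> (f u - f (u + d)) / (- deriv f (u + d)) = r"
  proof (rule connected_ex1_value_decreasing[where u = u and v = v])
    show "(f t - f (t + d)) / (- deriv f (t + d)) < (f s - f (s + d)) / (- deriv f (s + d))"
      if "s \<in> {0<..}" "t \<in> {0<..}" "s < t" for s t
    proof -
      have eq: "s + (t - s) = t" "s + d + (t - s) = t + d" by auto
      have "(f s - f (s + d)) * deriv f (t + d) < (f t - f (t + d)) * deriv f (s + d)"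
        using sh_shift_upper[OF f, of s "s + d" "t - s"] that assms unfolding eq by simp
      then show ?thesis using neg[of "s + d"] neg[of "t + d"] that assms by (simp add: field_simps)
    qed
    have "- deriv f (x + d) \<noteq> 0" if "0 < x" for x using neg'[of x] that by auto
    then show "continuous_on {0<..} (\<lambda>u. (f u - f (u + d)) / (- deriv f (u + d)))"
      using assms by (intro continuous_intros sh_continuous_comp[OF f]) auto
    show "(f u - f (u + d)) / (- deriv f (u + d)) < r" "r < (f v - f (v + d)) / (- deriv f (v + d))"
      using u' v' neg'[of u] neg'[of v] u v by (simp_all only: pos_divide_less_eq pos_less_divide_eq)
  qed (use u v in auto)
  moreover have "(f u - f (u + d)) / (- deriv f (u + d)) = r
      \<longleftrightarrow> f u - f (u + d) = r * (- deriv f (u + d))" if "0 < u" for u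
    using neg'[of u] that by (subst divide_eq_eq) auto
  ultimately show ?thesis by (metis greaterThan_iff)
qed

text \<open>The slope is prescribed on the branch of \<open>g\<close>, at distance \<open>u\<close>
  from the pole; the other point lies on the branch of \<open>f\<close>, at distance
  \<open>D - u\<close>.\<close>

lemma sh_ex1_gap_slope:
  assumes f: "strongly_hyperbolic f" and g: "strongly_hyperbolic g" and "0 < r" "0 < D"
  shows "\<exists>!u. 0 < u \<and> u < D \<and> f (D - u) + g u = r * (- deriv g u)"
proof -
  note pos = sh_pos[OF f] sh_pos[OF g] and dec = sh_strict_decreasing[OF f] sh_strict_decreasing[OF g]
    and neg = sh_deriv_neg[OF g]
  \<comment> \<open>The factor 2 leaves half of \<open>r * (- deriv g v)\<close> for each of the two
    summands.\<close>
  obtain v where v: "0 < v" "v < D / 2" "2 / r * g v < - deriv g v" "2 / r * f (D / 2) < - deriv g v"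
    using sh_steep_near_zero[OF g, of "2 / r" "D / 2" "2 / r * f (D / 2)"] assms by auto
  have "f (D - v) < f (D / 2)" using dec(1)[of "D / 2" "D - v"] v assms by simp
  then have v': "f (D - v) + g v < r * (- deriv g v)" using v assms by (simp add: field_simps)
  obtain w where w: "0 < w" "w < D / 2" "r * (- deriv g (D / 2)) < f w"
    using sh_large[OF f, of "D / 2"] assms by auto
  have "r * (- deriv g (D - w)) \<le> r * (- deriv g (D / 2))"
    using sh_deriv_mono[OF g, of "D / 2" "D - w"] w assms by simp
  then have w': "r * (- deriv g (D - w)) < f (D - (D - w)) + g (D - w)"
    using w(1-3) pos(2)[of "D - w"] assms by (simp only: diff_diff_eq2 add_diff_cancel_left') linarith
  have neg': "0 < - deriv g x" if "0 < x" for x using neg[of x] that by simp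
  have "\<exists>!u. u \<in> {0<..<D} \<and> (f (D - u) + g u) / (- deriv g u) = r"
  proof (rule connected_ex1_value_increasing[where u = v and v = "D - w"])
    show "(f (D - s) + g s) / (- deriv g s) < (f (D - t) + g t) / (- deriv g t)"
      if st: "s \<in> {0<..<D}" "t \<in> {0<..<D}" "s < t" for s t
    proof -
      have 1: "g s / (- deriv g s) < g t / (- deriv g t)"
        using sh_tail_strict[OF g, of s "t - s"] neg[of s] neg[of t] st by (simp add: field_simps)
      have 2: "f (D - s) / (- deriv g s) < f (D - t) / (- deriv g t)"
        using dec(1)[of "D - t" "D - s"] pos(1)[of "D - s"] sh_deriv_mono[OF g, of s t] neg'[of t] st
        by (intro frac_less) auto
      show ?thesis using 1 2 by (simp add: add_divide_distrib)
    qed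
    have "- deriv g x \<noteq> 0" if "0 < x" for x using neg'[of x] that by auto
    then show "continuous_on {0<..<D} (\<lambda>u. (f (D - u) + g u) / (- deriv g u))"
      using assms by (intro continuous_intros sh_continuous_comp[OF f] sh_continuous_comp[OF g]) auto
    show "(f (D - v) + g v) / (- deriv g v) < r"
      using v' neg'[of v] v by (simp only: pos_divide_less_eq)
    show "r < (f (D - (D - w)) + g (D - w)) / (- deriv g (D - w))"
      using w' neg'[of "D - w"] w by (simp only: pos_less_divide_eq)
  qed (use v w assms in auto)
  moreover have "(f (D - u) + g u) / (- deriv g u) = r
      \<longleftrightarrow> f (D - u) + g u = r * (- deriv g u)" if "0 < u" for u
    using neg'[of u] that by (subst divide_eq_eq) auto
  ultimately show ?thesis by (metis greaterThanLessThan_iff)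
qed

section \<open>The cyclic order of the circle\<close>

text \<open>The circle cut open at infinity, with \<open>Infty\<close> as largest element. Summing
  over rotations in \<open>cyc\<close> removes the dependence on the cut.\<close>

fun s1_less :: "s1 \<Rightarrow> s1 \<Rightarrow> bool" where
  "s1_less (Fin x) (Fin y) \<longleftrightarrow> x < y"
| "s1_less (Fin x) Infty \<longleftrightarrow> True"
| "s1_less Infty y \<longleftrightarrow> False"

definition cyc :: "s1 \<Rightarrow> s1 \<Rightarrow> s1 \<Rightarrow> bool" where
  "cyc x y z \<longleftrightarrow> s1_less x y \<and> s1_less y z \<or> s1_less y z \<and> s1_less z x \<or> s1_less z x \<and> s1_less x y"

lemma cyc_simps [simp]:
  "cyc (Fin x) (Fin y) (Fin z) \<longleftrightarrow> x < y \<and> y < z \<or> y < z \<and> z < x \<or> z < x \<and> x < y"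
  "cyc Infty (Fin x) (Fin y) \<longleftrightarrow> x < y"
  "cyc (Fin x) Infty (Fin y) \<longleftrightarrow> y < x"
  "cyc (Fin x) (Fin y) Infty \<longleftrightarrow> x < y"
  by (auto simp: cyc_def)

lemma cyc_irrefl [simp]: "\<not> cyc x x y" "\<not> cyc x y x" "\<not> cyc y x x"
  by (cases x; cases y; auto simp: cyc_def)+

lemma cyc_rotate: "cyc x y z \<Longrightarrow> cyc y z x"
  by (auto simp: cyc_def)

lemma cyc_total: "\<lbrakk>x \<noteq> y; y \<noteq> z; z \<noteq> x\<rbrakk> \<Longrightarrow> cyc x y z \<or> cyc z y x"
  by (cases x; cases y; cases z; auto)

lemma cyc_asym: "cyc x y z \<Longrightarrow> \<not> cyc z y x"
  by (cases x; cases y; cases z; auto)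

lemma cyc_distinct: "cyc x y z \<Longrightarrow> x \<noteq> y \<and> y \<noteq> z \<and> z \<noteq> x"
  by auto

lemma s1_neg_neg [simp]: "s1_neg (s1_neg x) = x"
  by (cases x) auto

lemma s1_neg_eq_iff [simp]: "s1_neg x = s1_neg y \<longleftrightarrow> x = y"
  by (metis s1_neg_neg)

lemma cyc_neg [simp]: "cyc (s1_neg x) (s1_neg y) (s1_neg z) \<longleftrightarrow> cyc z y x"
  by (cases x; cases y; cases z; auto)

lemma open_cyc_interval: "open {y. cyc a y b}"
proof -
  have "open {x. a < x \<and> x < b}" "open {x. a < x \<or> x < b}" "open {x. x < b \<and> b < a \<or> b < a \<and> a < x}" for a b :: real
    by (simp_all add: open_Collect_conj open_Collect_disj open_Collect_less)
  then show ?thesis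
    apply (cases a; cases b)
    apply (auto simp: open_s1_def open_Collect_conj open_Collect_disj open_Collect_less continuous_on_const continuous_on_id)
    subgoal for u v by (intro exI[of _ "\<bar>u\<bar> + \<bar>v\<bar>"]) (auto simp: abs_real_def split: if_splits)
    done
qed

text \<open>Together with \<open>open_cyc_interval\<close> this describes the topology by the cyclic
  order alone, with no special role left for \<open>Infty\<close>.\<close>

lemma cyc_neighbourhood:
  assumes "open U" "P \<in> U"
  shows "\<exists>a b. cyc a P b \<and> (\<forall>y. cyc a y b \<longrightarrow> y \<in> U)"
proof (cases P)
  case (Fin x)
  have "open {x. Fin x \<in> U}" using assms by (simp add: open_s1_def)
  then obtain e where e: "e > 0" "\<And>y. \<bar>y - x\<bar> < e \<Longrightarrow> Fin y \<in> U"
    using Fin assms(2) by (auto simp: open_dist dist_real_def)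
  show ?thesis
  proof (intro exI conjI allI impI)
    show "cyc (Fin (x - e)) P (Fin (x + e))" using e Fin by simp
    show "y \<in> U" if "cyc (Fin (x - e)) y (Fin (x + e))" for y
      using that e by (cases y) auto
  qed
next
  case Infty
  then obtain M where M: "\<And>y. M < \<bar>y\<bar> \<Longrightarrow> Fin y \<in> U" using assms by (auto simp: open_s1_def)
  show ?thesis
  proof (intro exI conjI allI impI)
    show "cyc (Fin (\<bar>M\<bar> + 1)) P (Fin (- \<bar>M\<bar> - 1))" using Infty by simp
    show "y \<in> U" if "cyc (Fin (\<bar>M\<bar> + 1)) y (Fin (- \<bar>M\<bar> - 1))" for y
      using that assms Infty M by (cases y) auto
  qed
qed

section \<open>Maps that reverse the cyclic order\<close>

definition cyc_rev :: "(s1 \<Rightarrow> s1) \<Rightarrow> bool" where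
  "cyc_rev g \<longleftrightarrow> (\<forall>x y z. cyc x y z \<longrightarrow> cyc (g z) (g y) (g x))"

lemma cyc_revI:
  assumes "\<And>x y. x < y \<Longrightarrow> cyc (h Infty) (h (Fin y)) (h (Fin x))"
    and "\<And>x y z. \<lbrakk>x < y; y < z\<rbrakk> \<Longrightarrow> cyc (h (Fin z)) (h (Fin y)) (h (Fin x))"
  shows "cyc_rev h"
  unfolding cyc_rev_def
proof (intro allI impI)
  fix x y z assume "cyc x y z"
  then show "cyc (h z) (h y) (h x)"
    by (cases x; cases y; cases z)
      (auto intro: assms cyc_rotate[OF assms(1)] cyc_rotate[OF cyc_rotate[OF assms(1)]]
        cyc_rotate[OF assms(2)] cyc_rotate[OF cyc_rotate[OF assms(2)]])
qed

lemma cyc_rev_inj: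
  assumes "cyc_rev g" shows "inj g"
proof (rule injI, rule ccontr)
  fix x y assume *: "g x = g y" "x \<noteq> y"
  \<comment> \<open>A collision of two values becomes visible in the order only through a third
    point.\<close>
  obtain z where "z \<noteq> x" "z \<noteq> y"
    by (metis (full_types) s1.distinct(1) s1.inject zero_neq_one)
  then have "cyc x y z \<or> cyc z y x" using * cyc_total by metis
  then show False using assms * cyc_distinct unfolding cyc_rev_def by metis
qed

lemma cyc_rev_iff:
  assumes "cyc_rev g" shows "cyc (g x) (g y) (g z) \<longleftrightarrow> cyc z y x"
  using assms cyc_total cyc_distinct cyc_asym unfolding cyc_rev_def by metis

text \<open>Surjectivity supplies preimages of the ends of an interval around \<open>g x\<close>;
  the order then shows that the preimage of the whole interval is again an interval.\<close>

lemma cyc_rev_continuous: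
  assumes "cyc_rev g" "surj g"
  shows "continuous_on UNIV g"
proof (subst continuous_on_open_vimage[OF open_UNIV], intro allI impI)
  fix U :: "s1 set" assume U: "open U"
  have "\<exists>T. open T \<and> x \<in> T \<and> T \<subseteq> g -` U" if x: "g x \<in> U" for x
  proof -
    obtain a' b' where ab: "cyc a' (g x) b'" "\<And>y. cyc a' y b' \<Longrightarrow> y \<in> U"
      using cyc_neighbourhood[OF U x] by blast
    obtain a b where "g a = a'" "g b = b'" using assms(2) by (metis surjD)
    then have "cyc b y a \<longleftrightarrow> cyc a' (g y) b'" for y by (auto simp: cyc_rev_iff[OF assms(1)])
    then show ?thesis
      using ab by (intro exI[of _ "{y. cyc b y a}"] conjI open_cyc_interval) auto
  qed
  then have "open (g -` U)" by (subst open_subopen) auto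
  then show "open (g -` U \<inter> UNIV)" by simp
qed

lemma cyc_rev_homeomorphism:
  assumes "cyc_rev g" "surj g"
  shows "homeomorphism UNIV UNIV g (inv g)"
proof -
  have inj: "inj g" by (rule cyc_rev_inj[OF assms(1)])
  have "cyc_rev (inv g)"
    unfolding cyc_rev_def using cyc_rev_iff[OF assms(1), of "inv g z" "inv g y" "inv g x" for x y z]
    by (simp add: surj_f_inv_f[OF assms(2)])
  moreover have "surj (inv g)" by (rule inj_imp_surj_inv[OF inj])
  ultimately show ?thesis
    using assms inj by (intro homeomorphismI cyc_rev_continuous) (auto simp: surj_f_inv_f)
qed

text \<open>Moving the point P to infinity: chart P parametrizes the complement of P by the real line,
  preserving the cyclic order.\<close>

fun chart :: "s1 \<Rightarrow> real \<Rightarrow> s1" where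
  "chart Infty u = Fin u"
| "chart (Fin p) u = (if u = 0 then Infty else Fin (p - 1 / u))"

lemma chart_cyc:
  assumes "u < v" shows "cyc P (chart P u) (chart P v)"
  using assms
  by (cases P; cases "u > 0"; cases "v > 0"; cases "u = 0"; cases "v = 0") (auto simp: field_simps)

lemma chart_neq: "chart P u \<noteq> P"
  by (cases P) auto

lemma chart_surj:
  assumes "X \<noteq> P" shows "\<exists>u. chart P u = X"
proof (cases P)
  case (Fin p)
  show ?thesis
  proof (cases X)
    case (Fin x)
    then show ?thesis using assms \<open>P = Fin p\<close> by (intro exI[of _ "1 / (p - x)"]) auto
  next
    case Infty
    then show ?thesis using Fin by (intro exI[of _ 0]) auto
  qed
next
  case Infty
  then show ?thesis using assms by (cases X) auto
qed

lemma chart_cyc_iff: "cyc P (chart P u) (chart P v) \<longleftrightarrow> u < v"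
  using chart_cyc[of u v P] chart_cyc[of v u P] cyc_asym cyc_rotate
  by (metis cyc_irrefl(3) linorder_neqE)

lemma chart_inj: "chart P u = chart P v \<longleftrightarrow> u = v"
  using chart_cyc_iff by (metis cyc_irrefl(3) linorder_neqE)

text \<open>The real function that represents \<open>g\<close> once \<open>P\<close> and
  \<open>Q\<close> have both been moved to infinity; meaningful for injective \<open>g\<close> with
  \<open>g P = Q\<close>.\<close>

definition in_charts :: "s1 \<Rightarrow> s1 \<Rightarrow> (s1 \<Rightarrow> s1) \<Rightarrow> real \<Rightarrow> real" where
  "in_charts P Q g u = (THE v. chart Q v = g (chart P u))"

lemma in_charts:
  assumes "inj g" "g P = Q" shows "chart Q (in_charts P Q g u) = g (chart P u)"
proof -
  have "g (chart P u) \<noteq> Q" using assms chart_neq by (metis injD)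
  then obtain v where v: "chart Q v = g (chart P u)" using chart_surj by metis
  show ?thesis unfolding in_charts_def by (rule theI[of _ v]) (use v chart_inj in metis)+
qed

lemma in_charts_surj:
  assumes "bij g" "g P = Q" shows "\<exists>u. in_charts P Q g u = v"
proof -
  obtain X where X: "g X = chart Q v" using assms bij_is_surj surjD by metis
  then have "X \<noteq> P" using assms chart_neq by metis
  then obtain u where "chart P u = X" using chart_surj by metis
  then have "in_charts P Q g u = v"
    using in_charts[OF bij_is_inj[OF assms(1)] assms(2)] X chart_inj by metis
  then show ?thesis by blast
qed

lemma in_charts_rev:
  assumes "cyc_rev g" "g P = Q" "u < v"
  shows "in_charts P Q g v < in_charts P Q g u"
proof -
  have "cyc P (chart P u) (chart P v)" using assms chart_cyc by simp
  then have "cyc Q (g (chart P v)) (g (chart P u))"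
    using assms(1,2) cyc_rotate unfolding cyc_rev_def by metis
  then show ?thesis
    using in_charts[OF cyc_rev_inj[OF assms(1)] assms(2)] chart_cyc_iff by metis
qed

text \<open>A monotone surjection of the line has no jumps; the sign change inside makes it
  increasing.\<close>

lemma in_charts_rev_continuous:
  assumes "cyc_rev g" "surj g" "g P = Q"
  shows "continuous_on UNIV (in_charts P Q g)"
proof -
  have "continuous_on UNIV (\<lambda>u. - in_charts P Q g u)"
  proof (rule continuous_onI_mono)
    have "range (\<lambda>u. - in_charts P Q g u) = UNIV"
      using in_charts_surj[of g P Q] cyc_rev_inj assms by (auto simp: bij_def surj_def) (metis minus_minus)
    then show "open (range (\<lambda>u. - in_charts P Q g u))" by simp
    show "- in_charts P Q g u \<le> - in_charts P Q g v" if "u \<le> v" for u v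
      using in_charts_rev[OF assms(1,3), of u v] that by (cases "u = v") auto
  qed
  then show ?thesis using continuous_on_minus by fastforce
qed

text \<open>In the charts both maps are continuous on the whole line. Thus \<open>X\<close> and
  \<open>Y\<close> may lie anywhere off \<open>P\<close>, and a zero of the difference is
  automatically a common point other than \<open>P\<close>.\<close>

lemma cyc_rev_crossing:
  assumes g: "cyc_rev g" "surj g" "g P = Q" and h: "cyc_rev h" "surj h" "h P = Q"
    and X: "cyc Q (g X) (h X)" and Y: "cyc Q (h Y) (g Y)"
  shows "\<exists>Z. Z \<noteq> P \<and> g Z = h Z"
proof -
  let ?G = "in_charts P Q g" and ?H = "in_charts P Q h"
  have GH: "chart Q (?G u) = g (chart P u)" "chart Q (?H u) = h (chart P u)" for u
    using in_charts cyc_rev_inj g h by auto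
  have "X \<noteq> P" "Y \<noteq> P" using X Y g h cyc_distinct by metis+
  then obtain u v where uv: "chart P u = X" "chart P v = Y" using chart_surj by metis
  have "?G u < ?H u" "?H v < ?G v" using X Y GH uv chart_cyc_iff by metis+
  moreover have "connected (range (\<lambda>u. ?G u - ?H u))"
    by (intro connected_continuous_image continuous_intros in_charts_rev_continuous g h connected_UNIV)
  ultimately have "0 \<in> range (\<lambda>u. ?G u - ?H u)"
    using connectedD_interval[of "range (\<lambda>u. ?G u - ?H u)" "?G u - ?H u" "?G v - ?H v" 0] by auto
  then obtain w where "?G w = ?H w" by auto
  then have "g (chart P w) = h (chart P w)" using GH by metis
  then show ?thesis using chart_neq by metis
qed

lemma cyc_rev_pres_meet_twice:
  assumes g: "cyc_rev g" "surj g" "g P = Q" and h: "cyc_rev (h \<circ> s1_neg)" "surj h" "h P = Q"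
  shows "\<exists>Z. Z \<noteq> P \<and> g Z = h Z"
proof -
  let ?k = "h \<circ> s1_neg"
  let ?G = "in_charts P Q g" and ?H = "in_charts P Q h"
  have inj: "inj h" using cyc_rev_inj[OF h(1)] by (metis comp_apply injD injI s1_neg_neg)
  have GH: "chart Q (?G u) = g (chart P u)" "chart Q (?H u) = h (chart P u)" for u
    using in_charts cyc_rev_inj g h inj by auto
  have dec: "?G v < ?G u" if "u < v" for u v using in_charts_rev g that by metis
  have inc: "?H u < ?H v" if "u < v" for u v
  proof -
    have "cyc (s1_neg (chart P v)) (s1_neg (chart P u)) (s1_neg P)" using that chart_cyc by simp
    then have "cyc (h P) (h (chart P u)) (h (chart P v))" using h(1) unfolding cyc_rev_def by fastforce
    then show ?thesis using GH h(3) chart_cyc_iff by metis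
  qed
  have contG: "continuous_on UNIV ?G" using in_charts_rev_continuous g by blast
  have Hsurj: "\<exists>u. ?H u = v" for v using in_charts_surj[of h P Q] inj h by (auto simp: bij_def)
  have contH: "continuous_on UNIV ?H"
  proof (rule continuous_onI_mono)
    have "range ?H = UNIV" using Hsurj by (auto simp: surj_def) metis
    then show "open (range ?H)" by simp
    show "?H u \<le> ?H v" if "u \<le> v" for u v using inc[of u v] that by (cases "u = v") auto
  qed
  \<comment> \<open>With this \<open>u\<close> the difference has opposite signs at \<open>0\<close>
    and \<open>u\<close>, unless \<open>u = 0\<close>: one function decreases, the other increases,
    and they share the value \<open>?G 0\<close>.\<close>
  obtain u where u: "?H u = ?G 0" using Hsurj by blast
  have conn: "connected (range (\<lambda>u. ?G u - ?H u))"
    by (intro connected_continuous_image continuous_intros contG contH connected_UNIV)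
  have "0 \<in> range (\<lambda>u. ?G u - ?H u)"
  proof (cases u "0 :: real" rule: linorder_cases)
    case less
    then show ?thesis using dec[of u 0] inc[of u 0] u
        connectedD_interval[OF conn, of "?G 0 - ?H 0" "?G u - ?H u" 0] by fastforce
  next
    case equal
    then show ?thesis using u by (auto intro!: image_eqI[of _ _ 0])
  next
    case greater
    then show ?thesis using dec[of 0 u] inc[of 0 u] u
        connectedD_interval[OF conn, of "?G u - ?H u" "?G 0 - ?H 0" 0] by fastforce
  qed
  then obtain w where "?G w = ?H w" by auto
  then have "g (chart P w) = h (chart P w)" using GH by metis
  then show ?thesis using chart_neq by metis
qed

section \<open>Circles as graphs\<close>

definition hyp_map :: "(real \<Rightarrow> real) \<Rightarrow> (real \<Rightarrow> real) \<Rightarrow> real \<Rightarrow> real \<Rightarrow> real \<Rightarrow> s1 \<Rightarrow> s1" where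
  "hyp_map f g a b c X =
     (case X of Infty \<Rightarrow> Fin c | Fin x \<Rightarrow> if x = - b then Infty else Fin (f_abc f g a b c x))"

definition lin_map :: "real \<Rightarrow> real \<Rightarrow> s1 \<Rightarrow> s1" where
  "lin_map s t X = (case X of Infty \<Rightarrow> Infty | Fin x \<Rightarrow> Fin (s * x + t))"

definition neg_maps :: "(real \<Rightarrow> real) \<Rightarrow> (real \<Rightarrow> real) \<Rightarrow> (s1 \<Rightarrow> s1) set" where
  "neg_maps f g = {hyp_map f g a b c | a b c. a > 0} \<union> {lin_map s t | s t. s < 0}"

definition graph :: "(s1 \<Rightarrow> s1) \<Rightarrow> point set" where
  "graph h = {(X, h X) | X. True}"

lemma graph_mem [simp]: "(X, Y) \<in> graph h \<longleftrightarrow> h X = Y"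
  by (auto simp: graph_def)

lemma graph_inject: "graph h = graph k \<longleftrightarrow> h = k"
  by (auto simp: graph_def set_eq_iff)

lemma lin_map_simps [simp]: "lin_map s t Infty = Infty" "lin_map s t (Fin x) = Fin (s * x + t)"
  by (auto simp: lin_map_def)

lemma hyp_map_simps [simp]:
  "hyp_map f g a b c Infty = Fin c"
  "hyp_map f g a b c (Fin (- b)) = Infty"
  "hyp_map f g a b c X = Infty \<longleftrightarrow> X = Fin (- b)"
  by (auto simp: hyp_map_def split: s1.split)

lemma hyp_map_right: "- b < x \<Longrightarrow> hyp_map f g a b c (Fin x) = Fin (a * f (x + b) + c)"
  and hyp_map_left: "x < - b \<Longrightarrow> hyp_map f g a b c (Fin x) = Fin (c - a * g (- x - b))"
  by (auto simp: hyp_map_def f_abc_def)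

lemma C_minus_graph: "C_minus f g = graph ` neg_maps f g"
proof -
  have hyp: "f_circle f g a b c = graph (hyp_map f g a b c)" for a b c
  proof (intro set_eqI)
    fix p :: point
    obtain X Y where "p = (X, Y)" by (cases p)
    then show "p \<in> f_circle f g a b c \<longleftrightarrow> p \<in> graph (hyp_map f g a b c)"
      by (cases X; cases Y) (auto simp: f_circle_def hyp_map_def)
  qed
  have lin: "l_circle s t = graph (lin_map s t)" for s t
  proof (intro set_eqI)
    fix p :: point
    obtain X Y where "p = (X, Y)" by (cases p)
    then show "p \<in> l_circle s t \<longleftrightarrow> p \<in> graph (lin_map s t)"
      by (cases X; cases Y) (auto simp: l_circle_def)
  qed
  show ?thesis
    unfolding C_minus_def neg_maps_def hyp lin image_Un by (rule arg_cong2[of _ _ _ _ "(\<union>)"]) blast+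
qed

lemma C_plus_graph: "C_plus f g = (\<lambda>h. graph (h \<circ> s1_neg)) ` neg_maps f g"
proof -
  have "phi ` graph h = graph (h \<circ> s1_neg)" for h
  proof (intro set_eqI iffI)
    fix p assume "p \<in> graph (h \<circ> s1_neg)"
    then obtain X where "p = (X, h (s1_neg X))" by (auto simp: graph_def)
    then show "p \<in> phi ` graph h"
      by (intro image_eqI[of _ _ "(s1_neg X, h (s1_neg X))"]) (auto simp: phi_def)
  qed (auto simp: phi_def graph_def)
  then show ?thesis by (auto simp: C_plus_def C_minus_graph image_image)
qed

text \<open>Conjugation with the half turn of the torus exchanges the two branches.\<close>

definition half_turn :: "(s1 \<Rightarrow> s1) \<Rightarrow> s1 \<Rightarrow> s1" where
  "half_turn h = s1_neg \<circ> h \<circ> s1_neg"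

lemma half_turn_half_turn [simp]: "half_turn (half_turn h) = h"
  by (auto simp: half_turn_def)

lemma half_turn_eq_iff: "half_turn h X = Y \<longleftrightarrow> h (s1_neg X) = s1_neg Y"
  by (auto simp: half_turn_def)

lemma half_turn_neg_maps: "half_turn h \<in> neg_maps g f \<longleftrightarrow> h \<in> neg_maps f g"
proof -
  have imp: "half_turn h \<in> neg_maps g f" if "h \<in> neg_maps f g" for f g h
  proof -
    have "half_turn (hyp_map f g a b c) = hyp_map g f a (- b) (- c)" for a b c
      by (rule ext) (auto simp: half_turn_def hyp_map_def f_abc_def algebra_simps split: s1.split)
    moreover have "half_turn (lin_map s t) = lin_map s (- t)" for s t
      by (rule ext) (auto simp: half_turn_def lin_map_def split: s1.split)
    ultimately show ?thesis using that unfolding neg_maps_def by force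
  qed
  show ?thesis using imp[of h f g] imp[of "half_turn h" g f] by auto
qed

text \<open>Lets a configuration be settled by quoting its rotated version with the two functions
  exchanged.\<close>

lemma ex1_neg_maps_half_turn:
  assumes "\<exists>!h. h \<in> neg_maps g f \<and> Q (half_turn h)"
  shows "\<exists>!h. h \<in> neg_maps f g \<and> Q h"
  using assms half_turn_neg_maps half_turn_half_turn by metis

lemma ex1_neg_maps_hyp:
  assumes "0 < a" "Q (hyp_map f g a b c)"
    and "\<And>a' b' c'. \<lbrakk>0 < a'; Q (hyp_map f g a' b' c')\<rbrakk> \<Longrightarrow> b' = b \<and> a' = a \<and> c' = c"
    and "\<And>s t. s < 0 \<Longrightarrow> \<not> Q (lin_map s t)"
  shows "\<exists>!h. h \<in> neg_maps f g \<and> Q h"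
proof (rule ex1I[of _ "hyp_map f g a b c"])
  show "h = hyp_map f g a b c" if "h \<in> neg_maps f g \<and> Q h" for h
    using that assms(3,4) by (auto simp: neg_maps_def)
qed (use assms(1,2) in \<open>auto simp: neg_maps_def\<close>)

lemma ex1_neg_maps_lin:
  assumes "s < 0" "Q (lin_map s t)"
    and "\<And>s' t'. \<lbrakk>s' < 0; Q (lin_map s' t')\<rbrakk> \<Longrightarrow> s' = s \<and> t' = t"
    and "\<And>a b c. 0 < a \<Longrightarrow> \<not> Q (hyp_map f g a b c)"
  shows "\<exists>!h. h \<in> neg_maps f g \<and> Q h"
proof (rule ex1I[of _ "lin_map s t"])
  show "h = lin_map s t" if "h \<in> neg_maps f g \<and> Q h" for h
    using that assms(3,4) by (auto simp: neg_maps_def)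
qed (use assms(1,2) in \<open>auto simp: neg_maps_def\<close>)

section \<open>Slopes at finite points\<close>

fun the_fin :: "s1 \<Rightarrow> real" where
  "the_fin (Fin x) = x"
| "the_fin Infty = 0"

definition has_slope :: "(s1 \<Rightarrow> s1) \<Rightarrow> real \<Rightarrow> real \<Rightarrow> bool" where
  "has_slope h x m \<longleftrightarrow> ((\<lambda>x. the_fin (h (Fin x))) has_real_derivative m) (at x)"

lemma has_slope_unique: "has_slope h x m \<Longrightarrow> has_slope h x m' \<longleftrightarrow> m' = m"
  unfolding has_slope_def using DERIV_unique by blast

lemma has_slope_lin [simp]: "has_slope (lin_map s t) x m \<longleftrightarrow> m = s"
proof -
  have "has_slope (lin_map s t) x s"
    unfolding has_slope_def by (auto intro!: derivative_eq_intros)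
  then show ?thesis using has_slope_unique by blast
qed

lemma has_slope_half_turn: "has_slope (half_turn h) x m \<longleftrightarrow> has_slope h (- x) m"
proof -
  have imp: "has_slope (half_turn h) x m" if "has_slope h (- x) m" for h x
  proof -
    \<comment> \<open>The default value 0 of \<open>the_fin\<close> at \<open>Infty\<close> is its
      own negative, so the identity holds at the pole as well.\<close>
    have *: "(\<lambda>x. the_fin (half_turn h (Fin x))) = (\<lambda>x. - the_fin (h (Fin (- x))))"
    proof
      show "the_fin (half_turn h (Fin x)) = - the_fin (h (Fin (- x)))" for x
        by (cases "h (Fin (- x))") (auto simp: half_turn_def)
    qed
    have "((\<lambda>x. the_fin (h (Fin (- x)))) has_real_derivative m * (- 1)) (at x)"
      using that unfolding has_slope_def
      by (intro DERIV_chain2[of "\<lambda>x. the_fin (h (Fin x))"]) (auto intro!: derivative_eq_intros)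
    then show ?thesis unfolding has_slope_def * by (auto dest: DERIV_minus)
  qed
  show ?thesis using imp[of h x] imp[of "half_turn h" "- x"] by auto
qed

lemma hyp_map_mono_right:
  assumes f: "strongly_hyperbolic f" and "0 < a" "- b < x" "x < x'"
  shows "a * f (x' + b) < a * f (x + b)"
  using sh_strict_decreasing[OF f, of "x + b" "x' + b"] assms by simp

lemma hyp_map_mono_left:
  assumes g: "strongly_hyperbolic g" and "0 < a" "x < x'" "x' < - b"
  shows "a * g (- x - b) < a * g (- x' - b)"
  using sh_strict_decreasing[OF g, of "- x' - b" "- x - b"] assms by simp

lemma has_slope_right:
  assumes f: "strongly_hyperbolic f" and "- b < x"
  shows "has_slope (hyp_map f g a b c) x m \<longleftrightarrow> m = a * deriv f (x + b)"
proof -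
  have "((\<lambda>x. a * f (x + b) + c) has_real_derivative a * deriv f (x + b)) (at x)"
    using sh_deriv[OF f, of "x + b"] assms
    by (auto intro!: derivative_eq_intros simp: DERIV_shift)
  then have "has_slope (hyp_map f g a b c) x (a * deriv f (x + b))"
    unfolding has_slope_def
  proof (rule has_field_derivative_transform_within_open[of _ _ _ "{- b<..}"])
  qed (use assms in \<open>auto simp: hyp_map_right\<close>)
  then show ?thesis using has_slope_unique by blast
qed

lemma has_slope_left:
  assumes g: "strongly_hyperbolic g" and "x < - b"
  shows "has_slope (hyp_map f g a b c) x m \<longleftrightarrow> m = a * deriv g (- x - b)"
proof -
  have "((\<lambda>x. g (- x - b)) has_real_derivative deriv g (- x - b) * (- 1)) (at x)"
    by (rule DERIV_chain2[of g]) (use sh_deriv[OF g, of "- x - b"] assms in \<open>auto intro!: derivative_eq_intros\<close>)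
  then have "((\<lambda>x. c - a * g (- x - b)) has_real_derivative a * deriv g (- x - b)) (at x)"
    by (auto intro!: derivative_eq_intros)
  then have "has_slope (hyp_map f g a b c) x (a * deriv g (- x - b))"
    unfolding has_slope_def
  proof (rule has_field_derivative_transform_within_open[of _ _ _ "{..<- b}"])
  qed (use assms in \<open>auto simp: hyp_map_left\<close>)
  then show ?thesis using has_slope_unique by blast
qed

context
  fixes f g :: "real \<Rightarrow> real"
  assumes f: "strongly_hyperbolic f" and g: "strongly_hyperbolic g"
begin

text \<open>Since \<open>f\<close> and \<open>g\<close> are positive, the sign of
  \<open>y - c\<close> reveals the branch. Branches can therefore be excluded by comparing
  ordinates.\<close>

lemma hyp_map_fin_iff:
  assumes "0 < a"
  shows "hyp_map f g a b c (Fin x) = Fin y \<longleftrightarrow>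
    - b < x \<and> c < y \<and> y = a * f (x + b) + c \<or> x < - b \<and> y < c \<and> y = c - a * g (- x - b)"
proof -
  consider "x = - b" | "- b < x" | "x < - b" by linarith
  then show ?thesis
    by cases (use assms sh_pos[OF f, of "x + b"] sh_pos[OF g, of "- x - b"]
        in \<open>auto simp: hyp_map_right hyp_map_left\<close>)
qed

lemma hyp_map_cyc_rev:
  assumes "0 < a" shows "cyc_rev (hyp_map f g a b c)"
proof (rule cyc_revI)
  have pos: "0 < a * f (w + b)" if "- b < w" for w using that assms sh_pos[OF f, of "w + b"] by simp
  have neg: "0 < a * g (- w - b)" if "w < - b" for w using that assms sh_pos[OF g, of "- w - b"] by simp
  note mono = hyp_map_mono_right[OF f assms] hyp_map_mono_left[OF g assms]
  fix x y :: real assume xy: "x < y"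
  consider "- b < x" | "x = - b" | "x < - b" "- b < y" | "y = - b" | "y < - b" using xy by linarith
  then show "cyc (hyp_map f g a b c Infty) (hyp_map f g a b c (Fin y)) (hyp_map f g a b c (Fin x))"
    by cases (use xy pos[of x] pos[of y] neg[of x] neg[of y] mono(1)[of b x y] mono(2)[of x y b]
        in \<open>simp_all add: hyp_map_right hyp_map_left\<close>)
  fix z assume yz: "y < z"
  consider "- b < x" | "x = - b" | "x < - b" "- b < y" | "y = - b" | "y < - b" "- b < z" | "z = - b" | "z < - b"
    using xy yz by linarith
  then show "cyc (hyp_map f g a b c (Fin z)) (hyp_map f g a b c (Fin y)) (hyp_map f g a b c (Fin x))"
    by cases (use xy yz pos[of x] pos[of y] pos[of z] neg[of x] neg[of y] neg[of z]
          mono(1)[of b x y] mono(2)[of x y b] mono(1)[of b y z] mono(2)[of y z b]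
        in \<open>simp_all add: hyp_map_right hyp_map_left\<close>)
qed

lemma hyp_map_surj:
  assumes "0 < a" shows "surj (hyp_map f g a b c)"
  unfolding surj_def
proof
  fix Y
  show "\<exists>X. Y = hyp_map f g a b c X"
  proof (cases Y)
    case (Fin y)
    consider "y = c" | "c < y" | "y < c" by linarith
    then show ?thesis
    proof cases
      case 1
      then show ?thesis using Fin by (intro exI[of _ Infty]) auto
    next
      case 2
      then obtain u where "0 < u" "f u = (y - c) / a" using sh_ex1_value[OF f, of "(y - c) / a"] assms by auto
      then show ?thesis using Fin assms by (intro exI[of _ "Fin (u - b)"]) (auto simp: hyp_map_right)
    next
      case 3
      then obtain u where "0 < u" "g u = (c - y) / a" using sh_ex1_value[OF g, of "(c - y) / a"] assms by auto
      then show ?thesis using Fin assms by (intro exI[of _ "Fin (- u - b)"]) (auto simp: hyp_map_left)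
    qed
  next
    case Infty
    then show ?thesis by (intro exI[of _ "Fin (- b)"]) auto
  qed
qed

lemma neg_maps_cyc_rev:
  assumes "h \<in> neg_maps f g" shows "cyc_rev h" "surj h"
proof -
  have "cyc_rev (lin_map s t)" if "s < 0" for s t
    by (rule cyc_revI) (use that in auto)
  moreover have "surj (lin_map s t)" if "s < 0" for s t
    unfolding surj_def
  proof
    show "\<exists>X. Y = lin_map s t X" for Y
      using that by (cases Y) (auto intro: exI[of _ "Fin ((the_fin Y - t) / s)"] exI[of _ Infty])
  qed
  ultimately show "cyc_rev h" "surj h"
    using assms hyp_map_cyc_rev hyp_map_surj by (auto simp: neg_maps_def)
qed

end

section \<open>Joining\<close>

lemma hyp_map_right_convex:
  assumes f: "strongly_hyperbolic f" and "0 < a" "- b < x1" "x1 < x2" "x2 < x3"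
    and "y1 = a * f (x1 + b) + c" "y2 = a * f (x2 + b) + c" "y3 = a * f (x3 + b) + c"
  shows "(y2 - y3) * (x2 - x1) < (y1 - y2) * (x3 - x2)"
proof -
  have "a * ((f (x2 + b) - f (x3 + b)) * (x2 - x1)) < a * ((f (x1 + b) - f (x2 + b)) * (x3 - x2))"
    using sh_chord_slopes[OF f, of "x1 + b" "x2 + b" "x3 + b"] assms by simp
  then show ?thesis unfolding assms(6-8) by (simp add: algebra_simps)
qed

lemma hyp_map_left_concave:
  assumes g: "strongly_hyperbolic g" and "0 < a" "x3 < - b" "x1 < x2" "x2 < x3"
    and "y1 = c - a * g (- x1 - b)" "y2 = c - a * g (- x2 - b)" "y3 = c - a * g (- x3 - b)"
  shows "(y1 - y2) * (x3 - x2) < (y2 - y3) * (x2 - x1)"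
proof -
  have eq: "- x2 - b - (- x3 - b) = x3 - x2" "- x1 - b - (- x2 - b) = x2 - x1" by auto
  have "a * ((g (- x2 - b) - g (- x1 - b)) * (x3 - x2)) < a * ((g (- x3 - b) - g (- x2 - b)) * (x2 - x1))"
    using sh_chord_slopes[OF g, of "- x3 - b" "- x2 - b" "- x1 - b"] assms(2-5) unfolding eq by simp
  then show ?thesis unfolding assms(6-8) by (simp add: algebra_simps)
qed

lemma join_inf_inf:
  assumes "x1 < x2" "y2 < y1"
  shows "\<exists>!h. h \<in> neg_maps f g \<and> h (Fin x1) = Fin y1 \<and> h (Fin x2) = Fin y2 \<and> h Infty = Infty"
proof -
  define s where "s = (y2 - y1) / (x2 - x1)"
  have s: "s < 0" "s * (x2 - x1) = y2 - y1" using assms by (auto simp: s_def field_simps)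
  show ?thesis
  proof (rule ex1_neg_maps_lin[of s _ "y1 - s * x1"])
    fix s' t' assume "s' < 0" "lin_map s' t' (Fin x1) = Fin y1 \<and> lin_map s' t' (Fin x2) = Fin y2 \<and> lin_map s' t' Infty = Infty"
    then have *: "s' * x1 + t' = y1" "s' * x2 + t' = y2" by auto
    then have "s' * (x2 - x1) = s * (x2 - x1)" using s by (simp add: algebra_simps)
    then have "s' = s" using assms by simp
    then show "s' = s \<and> t' = y1 - s * x1" using * by simp
  qed (use s in \<open>auto simp: algebra_simps\<close>)
qed

text \<open>Dividing the two incidence equations eliminates \<open>a\<close>. What remains is an
  equation for \<open>u = x1 + b\<close>, the distance of the first point from the pole;
  \<open>a\<close> is then read off from one point.\<close>

lemma join_fin_above:
  assumes f: "strongly_hyperbolic f" and g: "strongly_hyperbolic g" and "x1 < x2" "y2 < y1" "c < y2"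
  shows "\<exists>!h. h \<in> neg_maps f g \<and> h (Fin x1) = Fin y1 \<and> h (Fin x2) = Fin y2 \<and> h Infty = Fin c"
proof -
  define d r where "d = x2 - x1" and "r = (y1 - c) / (y2 - c)"
  have dr: "0 < d" "1 < r" "r * (y2 - c) = y1 - c" using assms by (auto simp: d_def r_def field_simps)
  obtain u where u: "0 < u" "f u = r * f (u + d)"
    and uniq: "\<And>u'. \<lbrakk>0 < u'; f u' = r * f (u' + d)\<rbrakk> \<Longrightarrow> u' = u"
    using sh_ex1_ratio_shift[OF f dr(2,1)] by blast
  define a b where "a = (y1 - c) / f u" and "b = u - x1"
  have xb: "x1 + b = u" "x2 + b = u + d" by (auto simp: b_def d_def)
  have a: "0 < a" "a * f u = y1 - c" using sh_pos[OF f u(1)] assms by (auto simp: a_def)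
  have "r * (a * f (u + d)) = r * (y2 - c)" using a(2) u(2) dr(3) by (simp add: mult_ac)
  then have e2: "a * f (u + d) = y2 - c" using dr(2) by (subst (asm) mult_cancel_left) auto
  show ?thesis
  proof (rule ex1_neg_maps_hyp[of a _ _ _ b c, OF a(1)])
    show "hyp_map f g a b c (Fin x1) = Fin y1 \<and> hyp_map f g a b c (Fin x2) = Fin y2 \<and> hyp_map f g a b c Infty = Fin c"
      using xb a e2 u dr by (simp add: hyp_map_right)
  next
    fix a' b' c'
    assume a': "0 < a'" and Q: "hyp_map f g a' b' c' (Fin x1) = Fin y1 \<and> hyp_map f g a' b' c' (Fin x2) = Fin y2 \<and> hyp_map f g a' b' c' Infty = Fin c"
    then have c': "c' = c" and *: "- b' < x1" "a' * f (x1 + b') = y1 - c" "a' * f (x2 + b') = y2 - c"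
      using assms by (auto simp: hyp_map_fin_iff[OF f g a'])
    have x2: "x1 + b' + d = x2 + b'" by (simp add: d_def)
    have "a' * f (x1 + b') = a' * (r * f (x1 + b' + d))" using * dr(3) unfolding x2 by (metis mult.left_commute)
    then have "x1 + b' = u" using uniq[of "x1 + b'"] a' * by simp
    then show "b' = b \<and> a' = a \<and> c' = c" using c' * sh_pos[OF f u(1)] by (auto simp: b_def a_def field_simps)
  qed auto
qed

lemma join_fin_across:
  assumes f: "strongly_hyperbolic f" and g: "strongly_hyperbolic g" and "x1 < x2" "y1 < c" "c < y2"
  shows "\<exists>!h. h \<in> neg_maps f g \<and> h (Fin x1) = Fin y1 \<and> h (Fin x2) = Fin y2 \<and> h Infty = Fin c"
proof -
  define D r where "D = x2 - x1" and "r = (y2 - c) / (c - y1)"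
  have dr: "0 < D" "0 < r" "r * (c - y1) = y2 - c" using assms by (auto simp: D_def r_def field_simps)
  obtain u where u: "0 < u" "u < D" "f u = r * g (D - u)"
    and uniq: "\<And>u'. \<lbrakk>0 < u'; u' < D; f u' = r * g (D - u')\<rbrakk> \<Longrightarrow> u' = u"
    using sh_ex1_ratio_opposite[OF f g dr(2,1)] by blast
  define a b where "a = (y2 - c) / f u" and "b = u - x2"
  have xb: "x2 + b = u" "- x1 - b = D - u" by (auto simp: b_def D_def)
  have a: "0 < a" "a * f u = y2 - c" using sh_pos[OF f u(1)] assms by (auto simp: a_def)
  have "r * (a * g (D - u)) = r * (c - y1)" using a(2) u(3) dr(3) by (simp add: mult_ac)
  then have e2: "a * g (D - u) = c - y1" using dr(2) by (subst (asm) mult_cancel_left) auto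
  show ?thesis
  proof (rule ex1_neg_maps_hyp[of a _ _ _ b c, OF a(1)])
    have "- b < x2" "x1 < - b" using xb u by linarith+
    then show "hyp_map f g a b c (Fin x1) = Fin y1 \<and> hyp_map f g a b c (Fin x2) = Fin y2 \<and> hyp_map f g a b c Infty = Fin c"
      using xb a e2 by (simp add: hyp_map_right hyp_map_left)
  next
    fix a' b' c'
    assume a': "0 < a'" and Q: "hyp_map f g a' b' c' (Fin x1) = Fin y1 \<and> hyp_map f g a' b' c' (Fin x2) = Fin y2 \<and> hyp_map f g a' b' c' Infty = Fin c"
    then have c': "c' = c" and *: "- b' < x2" "x1 < - b'" "a' * g (- x1 - b') = c - y1" "a' * f (x2 + b') = y2 - c"
      using assms by (auto simp: hyp_map_fin_iff[OF f g a'])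
    have x2: "D - (x2 + b') = - x1 - b'" by (simp add: D_def)
    have "a' * f (x2 + b') = a' * (r * g (D - (x2 + b')))" using * dr(3) unfolding x2 by (metis mult.left_commute)
    then have "x2 + b' = u" using uniq[of "x2 + b'"] a' * by (simp add: D_def)
    then show "b' = b \<and> a' = a \<and> c' = c" using c' * sh_pos[OF f u(1)] by (auto simp: b_def a_def field_simps)
  qed auto
qed

lemma join_fin_pole:
  assumes f: "strongly_hyperbolic f" and g: "strongly_hyperbolic g" and "x1 < x2" "c < y2"
  shows "\<exists>!h. h \<in> neg_maps f g \<and> h (Fin x1) = Infty \<and> h (Fin x2) = Fin y2 \<and> h Infty = Fin c"
proof -
  define a where "a = (y2 - c) / f (x2 - x1)"
  have p: "0 < f (x2 - x1)" using assms sh_pos by simp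
  have a: "0 < a" "a * f (x2 - x1) = y2 - c" using p assms by (auto simp: a_def)
  show ?thesis
    by (rule ex1_neg_maps_hyp[of a _ _ _ "- x1" c, OF a(1)])
      (use p a assms in \<open>auto simp: hyp_map_fin_iff[OF f g] a_def field_simps\<close>)
qed

lemma join_pole_decreasing:
  assumes f: "strongly_hyperbolic f" and g: "strongly_hyperbolic g" and "x1 < x2" "x2 < x3" "y3 < y2"
  shows "\<exists>!h. h \<in> neg_maps f g \<and> h (Fin x1) = Infty \<and> h (Fin x2) = Fin y2 \<and> h (Fin x3) = Fin y3"
proof -
  have p: "0 < f (x2 - x1) - f (x3 - x1)" "0 < f (x3 - x1)" using assms sh_pos sh_strict_decreasing[OF f] by simp_all
  define a where "a = (y2 - y3) / (f (x2 - x1) - f (x3 - x1))"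
  have a: "0 < a" "a * (f (x2 - x1) - f (x3 - x1)) = y2 - y3" using p assms by (auto simp: a_def)
  define c where "c = y2 - a * f (x2 - x1)"
  show ?thesis
  proof (rule ex1_neg_maps_hyp[of a _ _ _ "- x1" c, OF a(1)])
    show "hyp_map f g a (- x1) c (Fin x1) = Infty \<and> hyp_map f g a (- x1) c (Fin x2) = Fin y2 \<and> hyp_map f g a (- x1) c (Fin x3) = Fin y3"
      using assms a by (simp add: hyp_map_right c_def algebra_simps)
  next
    fix a' b' c'
    assume a': "0 < a'" and Q: "hyp_map f g a' b' c' (Fin x1) = Infty \<and> hyp_map f g a' b' c' (Fin x2) = Fin y2 \<and> hyp_map f g a' b' c' (Fin x3) = Fin y3"
    then have b': "b' = - x1" by auto
    then have *: "y2 = a' * f (x2 - x1) + c'" "y3 = a' * f (x3 - x1) + c'"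
      using Q assms by (auto simp: hyp_map_fin_iff[OF f g a'])
    then have "a' * (f (x2 - x1) - f (x3 - x1)) = a * (f (x2 - x1) - f (x3 - x1))"
      using a by (simp add: algebra_simps)
    then have "a' = a" using p by simp
    then show "b' = - x1 \<and> a' = a \<and> c' = c" using b' * by (simp add: c_def)
  qed auto
qed

lemma join_middle_pole:
  assumes f: "strongly_hyperbolic f" and g: "strongly_hyperbolic g" and "x1 < x2" "x2 < x3" "y1 < y3"
  shows "\<exists>!h. h \<in> neg_maps f g \<and> h (Fin x1) = Fin y1 \<and> h (Fin x2) = Infty \<and> h (Fin x3) = Fin y3"
proof -
  have p: "0 < f (x3 - x2) + g (x2 - x1)" using assms sh_pos[OF f] sh_pos[OF g] by (simp add: add_pos_pos)
  define a where "a = (y3 - y1) / (f (x3 - x2) + g (x2 - x1))"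
  have a: "0 < a" "a * (f (x3 - x2) + g (x2 - x1)) = y3 - y1" using p assms by (auto simp: a_def)
  define c where "c = y3 - a * f (x3 - x2)"
  show ?thesis
  proof (rule ex1_neg_maps_hyp[of a _ _ _ "- x2" c, OF a(1)])
    show "hyp_map f g a (- x2) c (Fin x1) = Fin y1 \<and> hyp_map f g a (- x2) c (Fin x2) = Infty \<and> hyp_map f g a (- x2) c (Fin x3) = Fin y3"
      using assms a by (simp add: hyp_map_right hyp_map_left c_def algebra_simps)
  next
    fix a' b' c'
    assume a': "0 < a'" and Q: "hyp_map f g a' b' c' (Fin x1) = Fin y1 \<and> hyp_map f g a' b' c' (Fin x2) = Infty \<and> hyp_map f g a' b' c' (Fin x3) = Fin y3"
    then have b': "b' = - x2" by auto
    then have *: "y3 = a' * f (x3 - x2) + c'" "y1 = c' - a' * g (x2 - x1)"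
      using Q assms by (auto simp: hyp_map_fin_iff[OF f g a'])
    then have "a' * (f (x3 - x2) + g (x2 - x1)) = a * (f (x3 - x2) + g (x2 - x1))"
      using a by (simp add: algebra_simps)
    then have "a' = a" using p by simp
    then show "b' = - x2 \<and> a' = a \<and> c' = c" using b' * by (simp add: c_def)
  qed auto
qed

text \<open>Differences of ordinates eliminate \<open>c\<close>, and their quotient \<open>r\<close>
  eliminates \<open>a\<close>. Convexity of the triple is exactly the solvability condition
  \<open>d / (e - d) < r\<close>.\<close>

lemma join_convex:
  assumes f: "strongly_hyperbolic f" and g: "strongly_hyperbolic g" and x: "x1 < x2" "x2 < x3" and y: "y2 < y1" "y3 < y2"
    and convex: "(y2 - y3) * (x2 - x1) < (y1 - y2) * (x3 - x2)"
  shows "\<exists>!h. h \<in> neg_maps f g \<and> h (Fin x1) = Fin y1 \<and> h (Fin x2) = Fin y2 \<and> h (Fin x3) = Fin y3"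
proof -
  define d e r where "d = x2 - x1" and "e = x3 - x1" and "r = (y1 - y2) / (y2 - y3)"
  have de: "0 < d" "d < e" "d / (e - d) < r" "r * (y2 - y3) = y1 - y2"
    using x y convex by (auto simp: d_def e_def r_def field_simps)
  obtain u where u: "0 < u" "f u - f (u + d) = r * (f (u + d) - f (u + e))"
    and uniq: "\<And>u'. \<lbrakk>0 < u'; f u' - f (u' + d) = r * (f (u' + d) - f (u' + e))\<rbrakk> \<Longrightarrow> u' = u"
    using sh_ex1_chord_ratio[OF f de(1-3)] by blast
  have den: "0 < f (u + d) - f (u + e)" using sh_strict_decreasing[OF f, of "u + d" "u + e"] u de by simp
  define a b where "a = (y2 - y3) / (f (u + d) - f (u + e))" and "b = u - x1"
  have a: "0 < a" "a * (f (u + d) - f (u + e)) = y2 - y3" using den y by (auto simp: a_def)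
  define c where "c = y2 - a * f (u + d)"
  have xb: "x1 + b = u" "x2 + b = u + d" "x3 + b = u + e" by (auto simp: b_def d_def e_def)
  have e1: "a * (f u - f (u + d)) = y1 - y2" using a(2) u(2) de(4) by (metis mult.left_commute)
  show ?thesis
  proof (rule ex1_neg_maps_hyp[of a _ _ _ b c, OF a(1)])
    have "- b < x1" "- b < x2" "- b < x3" using xb u de by linarith+
    then show "hyp_map f g a b c (Fin x1) = Fin y1 \<and> hyp_map f g a b c (Fin x2) = Fin y2 \<and> hyp_map f g a b c (Fin x3) = Fin y3"
      using xb a(2) e1 by (simp add: hyp_map_right c_def algebra_simps)
  next
    fix a' b' c'
    assume a': "0 < a'" and Q: "hyp_map f g a' b' c' (Fin x1) = Fin y1 \<and> hyp_map f g a' b' c' (Fin x2) = Fin y2 \<and> hyp_map f g a' b' c' (Fin x3) = Fin y3"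
    \<comment> \<open>Values right of the pole exceed those left of it, so a decreasing triple lies
      on one branch, and the left branch is concave.\<close>
    have *: "- b' < x1" "y1 = a' * f (x1 + b') + c'" "y2 = a' * f (x2 + b') + c'" "y3 = a' * f (x3 + b') + c'"
      using Q x y convex hyp_map_left_concave[OF g a', of x3 b' x1 x2 y1 c' y2 y3]
      unfolding hyp_map_fin_iff[OF f g a'] by argo+
    have xb': "x1 + b' + d = x2 + b'" "x1 + b' + e = x3 + b'" by (auto simp: d_def e_def)
    have diff: "a' * (f (x1 + b') - f (x1 + b' + d)) = y1 - y2" "a' * (f (x1 + b' + d) - f (x1 + b' + e)) = y2 - y3"
      using *(2-4) unfolding xb' by (auto simp: algebra_simps)
    have "a' * (f (x1 + b') - f (x1 + b' + d)) = a' * (r * (f (x1 + b' + d) - f (x1 + b' + e)))"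
      using diff de(4) by (metis mult.left_commute)
    then have u': "x1 + b' = u" using uniq[of "x1 + b'"] a' *(1) by simp
    then have "a' * (f (u + d) - f (u + e)) = a * (f (u + d) - f (u + e))" using diff(2) a(2) by simp
    then have "a' = a" using den by simp
    then show "b' = b \<and> a' = a \<and> c' = c" using *(3) u' xb'(1) by (auto simp: c_def b_def)
  next
    fix s t :: real
    show "\<not> (lin_map s t (Fin x1) = Fin y1 \<and> lin_map s t (Fin x2) = Fin y2 \<and> lin_map s t (Fin x3) = Fin y3)"
    proof
      assume "lin_map s t (Fin x1) = Fin y1 \<and> lin_map s t (Fin x2) = Fin y2 \<and> lin_map s t (Fin x3) = Fin y3"
      then have "(y2 - y3) * (x2 - x1) = (y1 - y2) * (x3 - x2)" by (auto simp: algebra_simps)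
      then show False using convex by simp
    qed
  qed
qed

text \<open>A decreasing triple lies on one branch, and a strictly convex or strictly concave branch
  contains no three collinear points, so only a line remains.\<close>

lemma join_collinear:
  assumes f: "strongly_hyperbolic f" and g: "strongly_hyperbolic g" and x: "x1 < x2" "x2 < x3" and y: "y2 < y1" "y3 < y2"
    and line: "(y2 - y3) * (x2 - x1) = (y1 - y2) * (x3 - x2)"
  shows "\<exists>!h. h \<in> neg_maps f g \<and> h (Fin x1) = Fin y1 \<and> h (Fin x2) = Fin y2 \<and> h (Fin x3) = Fin y3"
proof -
  define s where "s = (y2 - y1) / (x2 - x1)"
  have s: "s < 0" "s * (x2 - x1) = y2 - y1" using x y by (auto simp: s_def field_simps)
  have "(s * (x3 - x2)) * (x2 - x1) = (y3 - y2) * (x2 - x1)"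
    using line s(2) by (metis (no_types, opaque_lifting) minus_diff_eq mult.assoc mult.commute mult_minus_left)
  then have s3: "s * (x3 - x2) = y3 - y2" using x by simp
  show ?thesis
  proof (rule ex1_neg_maps_lin[of s _ "y1 - s * x1"])
    fix s' t' assume "s' < 0" "lin_map s' t' (Fin x1) = Fin y1 \<and> lin_map s' t' (Fin x2) = Fin y2 \<and> lin_map s' t' (Fin x3) = Fin y3"
    then have *: "s' * x1 + t' = y1" "s' * x2 + t' = y2" by auto
    then have "s' * (x2 - x1) = s * (x2 - x1)" using s by (simp add: algebra_simps)
    then have "s' = s" using x by simp
    then show "s' = s \<and> t' = y1 - s * x1" using * by simp
  next
    fix a b c :: real assume a: "0 < a"
    show "\<not> (hyp_map f g a b c (Fin x1) = Fin y1 \<and> hyp_map f g a b c (Fin x2) = Fin y2 \<and> hyp_map f g a b c (Fin x3) = Fin y3)"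
      unfolding hyp_map_fin_iff[OF f g a]
      using x y line hyp_map_left_concave[OF g a, of x3 b x1 x2 y1 c y2 y3]
        hyp_map_right_convex[OF f a, of b x1 x2 x3 y1 c y2 y3] by argo
  qed (use s s3 in \<open>auto simp: algebra_simps\<close>)
qed

lemma join_one_left:
  assumes f: "strongly_hyperbolic f" and g: "strongly_hyperbolic g" and x: "x1 < x2" "x2 < x3" and y: "y1 < y3" "y3 < y2"
  shows "\<exists>!h. h \<in> neg_maps f g \<and> h (Fin x1) = Fin y1 \<and> h (Fin x2) = Fin y2 \<and> h (Fin x3) = Fin y3"
proof -
  define d D r where "d = x3 - x2" and "D = x2 - x1" and "r = (y3 - y1) / (y2 - y3)"
  have dr: "0 < r" "0 < d" "0 < D" "r * (y2 - y3) = y3 - y1"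
    using x y by (auto simp: d_def D_def r_def field_simps)
  obtain u where u: "0 < u" "u < D" "f (u + d) + g (D - u) = r * (f u - f (u + d))"
    and uniq: "\<And>u'. \<lbrakk>0 < u'; u' < D; f (u' + d) + g (D - u') = r * (f u' - f (u' + d))\<rbrakk> \<Longrightarrow> u' = u"
    using sh_ex1_gap_ratio[OF f g dr(1-3)] by blast
  have den: "0 < f u - f (u + d)" using sh_strict_decreasing[OF f, of "u" "u + d"] u dr by simp
  define a b where "a = (y2 - y3) / (f u - f (u + d))" and "b = u - x2"
  have a: "0 < a" "a * (f u - f (u + d)) = y2 - y3" using den y by (auto simp: a_def)
  define c where "c = y2 - a * f u"
  have xb: "x2 + b = u" "x3 + b = u + d" "- x1 - b = D - u" by (auto simp: b_def d_def D_def)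
  have e1: "a * (f (u + d) + g (D - u)) = y3 - y1" using a(2) u(3) dr(4) by (metis mult.left_commute)
  show ?thesis
  proof (rule ex1_neg_maps_hyp[of a _ _ _ b c, OF a(1)])
    have b: "x1 < - b" "- b < x2" "- b < x3" using xb u dr by linarith+
    show "hyp_map f g a b c (Fin x1) = Fin y1 \<and> hyp_map f g a b c (Fin x2) = Fin y2 \<and> hyp_map f g a b c (Fin x3) = Fin y3"
      unfolding hyp_map_left[OF b(1)] hyp_map_right[OF b(2)] hyp_map_right[OF b(3)] xb c_def
      using a(2) e1 by (simp add: algebra_simps)
  next
    fix a' b' c'
    assume a': "0 < a'" and Q: "hyp_map f g a' b' c' (Fin x1) = Fin y1 \<and> hyp_map f g a' b' c' (Fin x2) = Fin y2 \<and> hyp_map f g a' b' c' (Fin x3) = Fin y3"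
    \<comment> \<open>Each branch decreases, so \<open>y1 < y2\<close> with \<open>x1 < x2\<close>
      puts the pole between these two points; \<open>x3\<close> is then on the right as
      well.\<close>
    have *: "x1 < - b'" "- b' < x2" "y1 = c' - a' * g (- x1 - b')" "y2 = a' * f (x2 + b') + c'" "y3 = a' * f (x3 + b') + c'"
      using Q x y hyp_map_mono_right[OF f a', of b' x1 x2] hyp_map_mono_left[OF g a', of x1 x2 b']
      unfolding hyp_map_fin_iff[OF f g a'] by argo+
    have xb': "x2 + b' + d = x3 + b'" "D - (x2 + b') = - x1 - b'" by (auto simp: d_def D_def)
    have diff: "a' * (f (x2 + b') - f (x2 + b' + d)) = y2 - y3" "a' * (f (x2 + b' + d) + g (D - (x2 + b'))) = y3 - y1"
      using *(3-5) unfolding xb' by (auto simp: algebra_simps)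
    have "a' * (f (x2 + b' + d) + g (D - (x2 + b'))) = a' * (r * (f (x2 + b') - f (x2 + b' + d)))"
      using diff dr(4) by (metis mult.left_commute)
    then have u': "x2 + b' = u" using uniq[of "x2 + b'"] a' *(1,2) by (simp add: D_def)
    then have "a' * (f u - f (u + d)) = a * (f u - f (u + d))" using diff(1) a(2) by simp
    then have "a' = a" using den by simp
    then show "b' = b \<and> a' = a \<and> c' = c" using *(4) u' by (auto simp: c_def b_def)
  next
    fix s t :: real assume "s < 0"
    then have "s * x2 < s * x1" using x by simp
    then show "\<not> (lin_map s t (Fin x1) = Fin y1 \<and> lin_map s t (Fin x2) = Fin y2 \<and> lin_map s t (Fin x3) = Fin y3)"
      using y by auto
  qed
qed

section \<open>Circles with a prescribed tangent\<close>

lemma hyp_map_slope_iff: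
  assumes f: "strongly_hyperbolic f" and g: "strongly_hyperbolic g" and a: "0 < a"
  shows "hyp_map f g a b c (Fin x) = Fin y \<and> has_slope (hyp_map f g a b c) x m \<longleftrightarrow>
    - b < x \<and> c < y \<and> y = a * f (x + b) + c \<and> m = a * deriv f (x + b) \<or>
    x < - b \<and> y < c \<and> y = c - a * g (- x - b) \<and> m = a * deriv g (- x - b)"
  unfolding hyp_map_fin_iff[OF f g a]
  using has_slope_right[OF f, of b x] has_slope_left[OF g, of x b] by auto

lemma hyp_map_right_tangent:
  assumes f: "strongly_hyperbolic f" and "0 < a" "- b < x" "- b < x'" "x \<noteq> x'"
    and "y = a * f (x + b) + c" "y' = a * f (x' + b) + c"
  shows "a * deriv f (x + b) * (x' - x) < y' - y"
proof -
  have "a * (f (x + b) + deriv f (x + b) * (x' - x)) < a * f (x' + b)"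
    using sh_tangent_strict[OF f, of "x + b" "x' + b"] assms by simp
  then show ?thesis unfolding assms(6,7) by (simp add: algebra_simps)
qed

lemma hyp_map_left_tangent:
  assumes g: "strongly_hyperbolic g" and "0 < a" "x < - b" "x' < - b" "x \<noteq> x'"
    and "y = c - a * g (- x - b)" "y' = c - a * g (- x' - b)"
  shows "y' - y < a * deriv g (- x - b) * (x' - x)"
proof -
  have eq: "- x' - b - (- x - b) = - (x' - x)" by simp
  have "a * (g (- x - b) + deriv g (- x - b) * - (x' - x)) < a * g (- x' - b)"
    using sh_tangent_strict[OF g, of "- x - b" "- x' - b"] assms(2-5) unfolding eq by simp
  then show ?thesis unfolding assms(6,7) by (simp add: algebra_simps)
qed

lemma tangent_inf_inf:
  assumes "m < 0"
  shows "\<exists>!h. h \<in> neg_maps f g \<and> (h (Fin x) = Fin y \<and> has_slope h x m) \<and> h Infty = Infty"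
  by (rule ex1_neg_maps_lin[of m _ "y - m * x"]) (use assms in auto)

text \<open>The quotient of slope and height over the asymptote eliminates \<open>a\<close> and
  leaves an equation for the distance \<open>u\<close> from the pole.\<close>

lemma tangent_inf_below:
  assumes f: "strongly_hyperbolic f" and g: "strongly_hyperbolic g" and "m < 0" "c < y"
  shows "\<exists>!h. h \<in> neg_maps f g \<and> (h (Fin x) = Fin y \<and> has_slope h x m) \<and> h Infty = Fin c"
proof -
  define r where "r = - m / (y - c)"
  have r: "0 < r" "r * (y - c) = - m" using assms by (auto simp: r_def field_simps)
  obtain u where u: "0 < u" "- deriv f u = r * f u"
    and uniq: "\<And>u'. \<lbrakk>0 < u'; - deriv f u' = r * f u'\<rbrakk> \<Longrightarrow> u' = u"
    using sh_ex1_log_deriv[OF f r(1)] by blast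
  have p: "0 < f u" using sh_pos[OF f u(1)] .
  define a b where "a = (y - c) / f u" and "b = u - x"
  have xb: "x + b = u" by (simp add: b_def)
  have a: "0 < a" "a * f u = y - c" using p assms by (auto simp: a_def)
  have m: "a * deriv f u = m"
  proof -
    have "a * - deriv f u = r * (a * f u)" unfolding u(2) by simp
    then show ?thesis unfolding a(2) r(2) by simp
  qed
  show ?thesis
  proof (rule ex1_neg_maps_hyp[of a _ _ _ b c, OF a(1)])
    show "(hyp_map f g a b c (Fin x) = Fin y \<and> has_slope (hyp_map f g a b c) x m) \<and> hyp_map f g a b c Infty = Fin c"
      unfolding hyp_map_slope_iff[OF f g a(1)] xb using assms a(2) m u xb by auto
  next
    fix a' b' c'
    assume a': "0 < a'" and Q: "(hyp_map f g a' b' c' (Fin x) = Fin y \<and> has_slope (hyp_map f g a' b' c') x m) \<and> hyp_map f g a' b' c' Infty = Fin c"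
    then have c': "c' = c" by simp
    then have *: "0 < x + b'" "a' * f (x + b') = y - c" "a' * deriv f (x + b') = m"
      using Q assms unfolding hyp_map_slope_iff[OF f g a'] by auto
    have "a' * - deriv f (x + b') = a' * (r * f (x + b'))"
      using r(2) *(2,3) by (metis mult.left_commute mult_minus_right)
    then have u': "x + b' = u" unfolding mult_cancel_left using uniq[of "x + b'"] a' *(1) by auto
    then have "a' * f u = a * f u" using *(2) a(2) by simp
    then have "a' = a" using p by simp
    then show "b' = b \<and> a' = a \<and> c' = c" using c' u' by (auto simp: b_def)
  qed auto
qed

lemma tangent_pole_left:
  assumes f: "strongly_hyperbolic f" and g: "strongly_hyperbolic g" and "m < 0" "x' < x"
  shows "\<exists>!h. h \<in> neg_maps f g \<and> (h (Fin x) = Fin y \<and> has_slope h x m) \<and> h (Fin x') = Infty"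
proof -
  have p: "deriv f (x - x') < 0" using sh_deriv_neg[OF f] assms by simp
  define a where "a = m / deriv f (x - x')"
  have a: "0 < a" "a * deriv f (x - x') = m" using p assms by (auto simp: a_def divide_neg_neg)
  have a'p: "0 < a' * f (x - x')" if "0 < a'" for a' using that sh_pos[OF f] assms by simp
  show ?thesis
  proof (rule ex1_neg_maps_hyp[of a _ _ _ "- x'" "y - a * f (x - x')", OF a(1)])
    show "(hyp_map f g a (- x') (y - a * f (x - x')) (Fin x) = Fin y
        \<and> has_slope (hyp_map f g a (- x') (y - a * f (x - x'))) x m)
      \<and> hyp_map f g a (- x') (y - a * f (x - x')) (Fin x') = Infty"
      unfolding hyp_map_slope_iff[OF f g a(1)] using assms a a'p[OF a(1)] by auto
  next
    fix a' b' c'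
    assume a': "0 < a'" and Q: "(hyp_map f g a' b' c' (Fin x) = Fin y \<and> has_slope (hyp_map f g a' b' c') x m) \<and> hyp_map f g a' b' c' (Fin x') = Infty"
    then have b': "b' = - x'" by simp
    then have *: "y = a' * f (x - x') + c'" "a' * deriv f (x - x') = a * deriv f (x - x')"
      using Q assms a(2) unfolding hyp_map_slope_iff[OF f g a'] by auto
    then have "a' = a" using p by simp
    then show "b' = - x' \<and> a' = a \<and> c' = y - a * f (x - x')" using * b' by simp
  qed auto
qed

lemma tangent_collinear:
  assumes f: "strongly_hyperbolic f" and g: "strongly_hyperbolic g" and "m < 0" "x < x'" "y' - y = m * (x' - x)"
  shows "\<exists>!h. h \<in> neg_maps f g \<and> (h (Fin x) = Fin y \<and> has_slope h x m) \<and> h (Fin x') = Fin y'"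
proof (rule ex1_neg_maps_lin[of m _ "y - m * x"])
  fix a b c :: real assume a: "0 < a"
  have "m * (x' - x) < 0" using assms by (simp add: mult_neg_pos)
  then have "y' < y" using assms by simp
  then show "\<not> ((hyp_map f g a b c (Fin x) = Fin y \<and> has_slope (hyp_map f g a b c) x m) \<and> hyp_map f g a b c (Fin x') = Fin y')"
    unfolding hyp_map_slope_iff[OF f g a] unfolding hyp_map_fin_iff[OF f g a]
    using assms(4,5) hyp_map_right_tangent[OF f a, of b x x' y c y'] hyp_map_left_tangent[OF g a, of x b x' y c y']
    by auto
qed (use assms in \<open>auto simp: algebra_simps\<close>)

text \<open>The second point lies above the tangent line but below the first point, which singles
  out the right branch. Here \<open>r\<close> is the run over which the tangent line would drop by
  \<open>y - y'\<close>, and convexity is the condition \<open>r < d\<close>.\<close>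

lemma tangent_convex:
  assumes f: "strongly_hyperbolic f" and g: "strongly_hyperbolic g" and "m < 0" "x < x'" "m * (x' - x) < y' - y" "y' < y"
  shows "\<exists>!h. h \<in> neg_maps f g \<and> (h (Fin x) = Fin y \<and> has_slope h x m) \<and> h (Fin x') = Fin y'"
proof -
  define d r where "d = x' - x" and "r = (y - y') / - m"
  have dr: "0 < r" "r < d" "r * - m = y - y'"
    using assms by (auto simp: d_def r_def field_simps)
  obtain u where u: "0 < u" "f u - f (u + d) = r * (- deriv f u)"
    and uniq: "\<And>u'. \<lbrakk>0 < u'; f u' - f (u' + d) = r * (- deriv f u')\<rbrakk> \<Longrightarrow> u' = u"
    using sh_ex1_chord_left_slope[OF f dr(1,2)] by blast
  have p: "deriv f u < 0" using sh_deriv_neg[OF f u(1)] .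
  define a b where "a = m / deriv f u" and "b = u - x"
  have a: "0 < a" "a * deriv f u = m" using p assms by (auto simp: a_def divide_neg_neg)
  define c where "c = y - a * f u"
  have xb: "x + b = u" "x' + b = u + d" by (auto simp: b_def d_def)
  have pos: "0 < a * f u" "0 < a * f (u + d)" using a u dr sh_pos[OF f] by auto
  have e: "a * (f u - f (u + d)) = y - y'"
  proof -
    have "a * (f u - f (u + d)) = r * - (a * deriv f u)" unfolding u(2) by simp
    then show ?thesis unfolding a(2) dr(3) .
  qed
  show ?thesis
  proof (rule ex1_neg_maps_hyp[of a _ _ _ b c, OF a(1)])
    have "- b < x" "- b < x'" using xb u dr by linarith+
    then show "(hyp_map f g a b c (Fin x) = Fin y \<and> has_slope (hyp_map f g a b c) x m) \<and> hyp_map f g a b c (Fin x') = Fin y'"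
      unfolding hyp_map_slope_iff[OF f g a(1)] unfolding hyp_map_fin_iff[OF f g a(1)] xb c_def
      using pos a(2) e by (auto simp: algebra_simps)
  next
    fix a' b' c'
    assume a': "0 < a'" and Q: "(hyp_map f g a' b' c' (Fin x) = Fin y \<and> has_slope (hyp_map f g a' b' c') x m) \<and> hyp_map f g a' b' c' (Fin x') = Fin y'"
    \<comment> \<open>A pole between the points would require \<open>y < y'\<close>, and the left
      branch stays below its tangent.\<close>
    have *: "- b' < x" "y = a' * f (x + b') + c'" "m = a' * deriv f (x + b')" "y' = a' * f (x' + b') + c'"
      using Q assms(3-) hyp_map_left_tangent[OF g a', of x b' x' y c' y']
      unfolding hyp_map_slope_iff[OF f g a'] unfolding hyp_map_fin_iff[OF f g a'] by auto
    have xb': "x + b' + d = x' + b'" by (auto simp: d_def)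
    have diff: "a' * (f (x + b') - f (x + b' + d)) = y - y'"
      using *(2,4) unfolding xb' by (auto simp: algebra_simps)
    have "a' * (f (x + b') - f (x + b' + d)) = a' * (r * - deriv f (x + b'))"
      using diff dr(3) *(3) by (metis mult.left_commute mult_minus_right)
    then have u': "x + b' = u" unfolding mult_cancel_left using uniq[of "x + b'"] a' *(1) by auto
    then have "a' * deriv f u = a * deriv f u" using *(3) a(2) by auto
    then have "a' = a" using p by simp
    then show "b' = b \<and> a' = a \<and> c' = c" using *(2) u' by (auto simp: c_def b_def)
  qed (use assms in \<open>auto simp: algebra_simps\<close>)
qed

text \<open>A second point below the tangent line forces the left branch. There \<open>x'\<close> is
  nearer to the pole, so \<open>u\<close> is its distance and the slope is prescribed at
  \<open>u + d\<close>.\<close>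

lemma tangent_concave:
  assumes f: "strongly_hyperbolic f" and g: "strongly_hyperbolic g" and "m < 0" "x < x'" "y' - y < m * (x' - x)"
  shows "\<exists>!h. h \<in> neg_maps f g \<and> (h (Fin x) = Fin y \<and> has_slope h x m) \<and> h (Fin x') = Fin y'"
proof -
  have y: "y' < y" using assms mult_neg_pos[of m "x' - x"] by simp
  define d r where "d = x' - x" and "r = (y - y') / - m"
  have dr: "0 < d" "d < r" "r * - m = y - y'"
    using assms by (auto simp: d_def r_def field_simps)
  obtain u where u: "0 < u" "g u - g (u + d) = r * (- deriv g (u + d))"
    and uniq: "\<And>u'. \<lbrakk>0 < u'; g u' - g (u' + d) = r * (- deriv g (u' + d))\<rbrakk> \<Longrightarrow> u' = u"
    using sh_ex1_chord_right_slope[OF g dr(1,2)] by blast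
  have p: "deriv g (u + d) < 0" using sh_deriv_neg[OF g, of "u + d"] u dr by simp
  define a b where "a = m / deriv g (u + d)" and "b = - x' - u"
  have a: "0 < a" "a * deriv g (u + d) = m" using p assms by (auto simp: a_def divide_neg_neg)
  define c where "c = y + a * g (u + d)"
  have xb: "- x' - b = u" "- x - b = u + d" by (auto simp: b_def d_def)
  have pos: "0 < a * g u" "0 < a * g (u + d)" using a u dr sh_pos[OF g] by auto
  have e: "a * (g u - g (u + d)) = y - y'"
  proof -
    have "a * (g u - g (u + d)) = r * - (a * deriv g (u + d))" unfolding u(2) by simp
    then show ?thesis unfolding a(2) dr(3) .
  qed
  show ?thesis
  proof (rule ex1_neg_maps_hyp[of a _ _ _ b c, OF a(1)])
    have "x < - b" "x' < - b" using xb u dr by linarith+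
    then show "(hyp_map f g a b c (Fin x) = Fin y \<and> has_slope (hyp_map f g a b c) x m) \<and> hyp_map f g a b c (Fin x') = Fin y'"
      unfolding hyp_map_slope_iff[OF f g a(1)] unfolding hyp_map_fin_iff[OF f g a(1)] xb c_def
      using pos a(2) e by (auto simp: algebra_simps)
  next
    fix a' b' c'
    assume a': "0 < a'" and Q: "(hyp_map f g a' b' c' (Fin x) = Fin y \<and> has_slope (hyp_map f g a' b' c') x m) \<and> hyp_map f g a' b' c' (Fin x') = Fin y'"
    have *: "x' < - b'" "y = c' - a' * g (- x - b')" "m = a' * deriv g (- x - b')" "y' = c' - a' * g (- x' - b')"
      using Q assms(3-) y hyp_map_right_tangent[OF f a', of b' x x' y c' y']
      unfolding hyp_map_slope_iff[OF f g a'] unfolding hyp_map_fin_iff[OF f g a'] by auto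
    have xb': "- x' - b' + d = - x - b'" by (auto simp: d_def)
    have diff: "a' * (g (- x' - b') - g (- x' - b' + d)) = y - y'"
      using *(2,4) unfolding xb' by (auto simp: algebra_simps)
    have "a' * (g (- x' - b') - g (- x' - b' + d)) = a' * (r * - deriv g (- x' - b' + d))"
      using diff dr(3) *(3) unfolding xb' by (metis mult.left_commute mult_minus_right)
    then have u': "- x' - b' = u" unfolding mult_cancel_left using uniq[of "- x' - b'"] a' *(1) by auto
    then have u'': "- x - b' = u + d" using xb' by simp
    then have "a' * deriv g (u + d) = a * deriv g (u + d)" using *(3) a(2) by auto
    then have "a' = a" using p by simp
    then show "b' = b \<and> a' = a \<and> c' = c" using *(2) u' u'' by (auto simp: c_def b_def)
  qed (use assms in \<open>auto simp: algebra_simps\<close>)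
qed

lemma tangent_across:
  assumes f: "strongly_hyperbolic f" and g: "strongly_hyperbolic g" and "m < 0" "x < x'" "y < y'"
  shows "\<exists>!h. h \<in> neg_maps f g \<and> (h (Fin x) = Fin y \<and> has_slope h x m) \<and> h (Fin x') = Fin y'"
proof -
  define D r where "D = x' - x" and "r = (y' - y) / - m"
  have dr: "0 < r" "0 < D" "r * - m = y' - y"
    using assms by (auto simp: D_def r_def divide_pos_neg)
  obtain u where u: "0 < u" "u < D" "f (D - u) + g u = r * (- deriv g u)"
    and uniq: "\<And>u'. \<lbrakk>0 < u'; u' < D; f (D - u') + g u' = r * (- deriv g u')\<rbrakk> \<Longrightarrow> u' = u"
    using sh_ex1_gap_slope[OF f g dr(1,2)] by blast
  have p: "deriv g u < 0" using sh_deriv_neg[OF g u(1)] .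
  define a b where "a = m / deriv g u" and "b = - x - u"
  have a: "0 < a" "a * deriv g u = m" using p assms by (auto simp: a_def divide_neg_neg)
  define c where "c = y + a * g u"
  have xb: "- x - b = u" "x' + b = D - u" by (auto simp: b_def D_def)
  have pos: "0 < a * g u" "0 < a * f (D - u)" using a u dr sh_pos[OF g] sh_pos[OF f] by auto
  have e: "a * (f (D - u) + g u) = y' - y"
  proof -
    have "a * (f (D - u) + g u) = r * - (a * deriv g u)" unfolding u(3) by simp
    then show ?thesis unfolding a(2) dr(3) .
  qed
  show ?thesis
  proof (rule ex1_neg_maps_hyp[of a _ _ _ b c, OF a(1)])
    have "x < - b" "- b < x'" using xb u dr by linarith+
    then show "(hyp_map f g a b c (Fin x) = Fin y \<and> has_slope (hyp_map f g a b c) x m) \<and> hyp_map f g a b c (Fin x') = Fin y'"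
      unfolding hyp_map_slope_iff[OF f g a(1)] unfolding hyp_map_fin_iff[OF f g a(1)] xb c_def
      using pos a(2) e by (auto simp: algebra_simps)
  next
    fix a' b' c'
    assume a': "0 < a'" and Q: "(hyp_map f g a' b' c' (Fin x) = Fin y \<and> has_slope (hyp_map f g a' b' c') x m) \<and> hyp_map f g a' b' c' (Fin x') = Fin y'"
    \<comment> \<open>Neither branch can rise from \<open>y\<close> to \<open>y'\<close>, so the
      pole separates the two points.\<close>
    have *: "x < - b'" "- b' < x'" "y = c' - a' * g (- x - b')" "m = a' * deriv g (- x - b')" "y' = a' * f (x' + b') + c'"
      using Q assms(3-) hyp_map_mono_right[OF f a', of b' x x'] hyp_map_mono_left[OF g a', of x x' b']
      unfolding hyp_map_slope_iff[OF f g a'] unfolding hyp_map_fin_iff[OF f g a'] by argo+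
    have xb': "D - (- x - b') = x' + b'" by (auto simp: D_def)
    have diff: "a' * (f (D - (- x - b')) + g (- x - b')) = y' - y"
      using *(3,5) unfolding xb' by (auto simp: algebra_simps)
    have "a' * (f (D - (- x - b')) + g (- x - b')) = a' * (r * - deriv g (- x - b'))"
      using diff dr(3) *(4) by (metis mult.left_commute mult_minus_right)
    then have u': "- x - b' = u" unfolding mult_cancel_left using uniq[of "- x - b'"] a' *(1,2) by (auto simp: D_def)
    then have "a' * deriv g u = a * deriv g u" using *(4) a(2) by auto
    then have "a' = a" using p by simp
    then show "b' = b \<and> a' = a \<and> c' = c" using *(3) u' by (auto simp: c_def b_def)
  next
    fix s t :: real assume "s < 0"
    then have "s * x' < s * x" using assms by simp
    then show "\<not> ((lin_map s t (Fin x) = Fin y \<and> has_slope (lin_map s t) x m) \<and> lin_map s t (Fin x') = Fin y')"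
      using assms by auto
  qed
qed

section \<open>The Minkowski plane\<close>

lemma join_at_infinity:
  assumes f: "strongly_hyperbolic f" and g: "strongly_hyperbolic g" and x: "x1 < x2" and Y: "cyc Y Y2 Y1"
  shows "\<exists>!h. h \<in> neg_maps f g \<and> h (Fin x1) = Y1 \<and> h (Fin x2) = Y2 \<and> h Infty = Y"
proof (cases Y)
  case (Fin c)
  \<comment> \<open>The cases are the cyclic positions of \<open>Fin c\<close> among the two values.
    \<open>pole2\<close> and \<open>below\<close> are the half turns of \<open>pole1\<close> and
    \<open>above\<close>.\<close>
  consider (pole1) y2 where "Y1 = Infty" "Y2 = Fin y2" "c < y2"
    | (pole2) y1 where "Y1 = Fin y1" "Y2 = Infty" "y1 < c"
    | (above) y1 y2 where "Y1 = Fin y1" "Y2 = Fin y2" "c < y2" "y2 < y1"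
    | (below) y1 y2 where "Y1 = Fin y1" "Y2 = Fin y2" "y2 < y1" "y1 < c"
    | (across) y1 y2 where "Y1 = Fin y1" "Y2 = Fin y2" "y1 < c" "c < y2"
    using Y Fin by (cases Y1; cases Y2) auto
  then show ?thesis
  proof cases
    case pole1
    then show ?thesis using join_fin_pole[OF f g x] Fin by simp
  next
    case pole2
    show ?thesis
      by (rule ex1_neg_maps_half_turn)
        (use pole2 join_fin_pole[OF g f, of "- x2" "- x1" "- c" "- y1"] x Fin in \<open>simp add: half_turn_eq_iff conj_ac\<close>)
  next
    case above
    then show ?thesis using join_fin_above[OF f g x] Fin by simp
  next
    case below
    show ?thesis
      by (rule ex1_neg_maps_half_turn)
        (use below join_fin_above[OF g f, of "- x2" "- x1" "- y1" "- y2" "- c"] x Fin in \<open>simp add: half_turn_eq_iff conj_ac\<close>)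
  next
    case across
    then show ?thesis using join_fin_across[OF f g x] Fin by simp
  qed
next
  case Infty
  then obtain y1 y2 where "Y1 = Fin y1" "Y2 = Fin y2" "y2 < y1"
    using Y by (cases Y1; cases Y2) auto
  then show ?thesis using join_inf_inf[OF x] Infty by simp
qed

lemma join_finite:
  assumes f: "strongly_hyperbolic f" and g: "strongly_hyperbolic g"
    and x: "x1 < x2" "x2 < x3" and Y: "cyc Y3 Y2 Y1"
  shows "\<exists>!h. h \<in> neg_maps f g \<and> h (Fin x1) = Y1 \<and> h (Fin x2) = Y2 \<and> h (Fin x3) = Y3"
proof -
  consider (pole1) y2 y3 where "Y1 = Infty" "Y2 = Fin y2" "Y3 = Fin y3" "y3 < y2"
    | (pole2) y1 y3 where "Y1 = Fin y1" "Y2 = Infty" "Y3 = Fin y3" "y1 < y3"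
    | (pole3) y1 y2 where "Y1 = Fin y1" "Y2 = Fin y2" "Y3 = Infty" "y2 < y1"
    | (one_branch) y1 y2 y3 where "Y1 = Fin y1" "Y2 = Fin y2" "Y3 = Fin y3" "y2 < y1" "y3 < y2"
    | (one_left) y1 y2 y3 where "Y1 = Fin y1" "Y2 = Fin y2" "Y3 = Fin y3" "y1 < y3" "y3 < y2"
    | (two_left) y1 y2 y3 where "Y1 = Fin y1" "Y2 = Fin y2" "Y3 = Fin y3" "y2 < y1" "y1 < y3"
    using Y by (cases Y1; cases Y2; cases Y3) auto
  then show ?thesis
  proof cases
    case pole1
    then show ?thesis using join_pole_decreasing[OF f g x] by simp
  next
    case pole2
    then show ?thesis using join_middle_pole[OF f g x] by simp
  next
    case pole3
    show ?thesis
      by (rule ex1_neg_maps_half_turn)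
        (use pole3 join_pole_decreasing[OF g f, of "- x3" "- x2" "- x1" "- y1" "- y2"] x in \<open>simp add: half_turn_eq_iff conj_ac\<close>)
  next
    case one_branch
    consider "(y2 - y3) * (x2 - x1) < (y1 - y2) * (x3 - x2)" | "(y2 - y3) * (x2 - x1) = (y1 - y2) * (x3 - x2)"
      | (concave) "(y1 - y2) * (x3 - x2) < (y2 - y3) * (x2 - x1)" by linarith
    then show ?thesis
    proof cases
      case concave
      \<comment> \<open>The half turn reverses the order of the three points and makes a concave
        triple convex.\<close>
      have eq: "- y2 - - y1 = y1 - y2" "- x2 - - x3 = x3 - x2" "- y3 - - y2 = y2 - y3" "- x1 - - x2 = x2 - x1" by auto
      show ?thesis
        by (rule ex1_neg_maps_half_turn)
          (use one_branch concave join_convex[OF g f, of "- x3" "- x2" "- x1" "- y2" "- y3" "- y1", unfolded eq] x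
            in \<open>simp add: half_turn_eq_iff conj_ac\<close>)
    qed (use one_branch join_convex[OF f g x] join_collinear[OF f g x] in simp_all)
  next
    case one_left
    then show ?thesis using join_one_left[OF f g x] by simp
  next
    case two_left
    show ?thesis
      by (rule ex1_neg_maps_half_turn)
        (use two_left join_one_left[OF g f, of "- x3" "- x2" "- x1" "- y3" "- y1" "- y2"] x in \<open>simp add: half_turn_eq_iff conj_ac\<close>)
  qed
qed

lemma join_neg_maps:
  assumes f: "strongly_hyperbolic f" and g: "strongly_hyperbolic g"
    and X: "cyc X1 X2 X3" and Y: "cyc Y3 Y2 Y1"
  shows "\<exists>!h. h \<in> neg_maps f g \<and> h X1 = Y1 \<and> h X2 = Y2 \<and> h X3 = Y3"
proof -
  have Y': "cyc Y1 Y3 Y2" "cyc Y2 Y1 Y3" using Y cyc_rotate by blast+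
  consider (i1) x2 x3 where "X1 = Infty" "X2 = Fin x2" "X3 = Fin x3" "x2 < x3"
    | (i2) x1 x3 where "X1 = Fin x1" "X2 = Infty" "X3 = Fin x3" "x3 < x1"
    | (i3) x1 x2 where "X1 = Fin x1" "X2 = Fin x2" "X3 = Infty" "x1 < x2"
    | (f1) x1 x2 x3 where "X1 = Fin x1" "X2 = Fin x2" "X3 = Fin x3" "x1 < x2" "x2 < x3"
    | (f2) x1 x2 x3 where "X1 = Fin x1" "X2 = Fin x2" "X3 = Fin x3" "x2 < x3" "x3 < x1"
    | (f3) x1 x2 x3 where "X1 = Fin x1" "X2 = Fin x2" "X3 = Fin x3" "x3 < x1" "x1 < x2"
    using X by (cases X1; cases X2; cases X3) auto
  then show ?thesis
  proof cases
    case i1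
    then show ?thesis using join_at_infinity[OF f g i1(4) Y'(1)] by (simp add: conj_ac)
  next
    case i2
    then show ?thesis using join_at_infinity[OF f g i2(4) Y'(2)] by (simp add: conj_ac)
  next
    case i3
    then show ?thesis using join_at_infinity[OF f g i3(4) Y] by (simp add: conj_ac)
  next
    case f1
    then show ?thesis using join_finite[OF f g f1(4,5) Y] by (simp add: conj_ac)
  next
    case f2
    then show ?thesis using join_finite[OF f g f2(4,5) Y'(1)] by (simp add: conj_ac)
  next
    case f3
    then show ?thesis using join_finite[OF f g f3(4,5) Y'(2)] by (simp add: conj_ac)
  qed
qed

lemma tangent_neg_maps:
  assumes f: "strongly_hyperbolic f" and g: "strongly_hyperbolic g"
    and m: "m < 0" and X: "X \<noteq> Fin x" and Y: "Y \<noteq> Fin y"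
  shows "\<exists>!h. h \<in> neg_maps f g \<and> (h (Fin x) = Fin y \<and> has_slope h x m) \<and> h X = Y"
proof -
  note turn = half_turn_eq_iff has_slope_half_turn
  \<comment> \<open>Stated for arbitrary functions and points because a second point on the left is
    brought to the right by a half turn, which exchanges \<open>f\<close> and \<open>g\<close> and
    keeps slopes.\<close>
  have to_right: "\<exists>!h. h \<in> neg_maps f g \<and> (h (Fin x) = Fin y \<and> has_slope h x m) \<and> h (Fin x') = Fin y'"
    if "strongly_hyperbolic f" "strongly_hyperbolic g" "x < x'" "y' \<noteq> y" for f g x y x' y'
  proof -
    consider "y < y'" | "m * (x' - x) < y' - y" "y' < y" | "y' - y = m * (x' - x)" | "y' - y < m * (x' - x)"
      using \<open>y' \<noteq> y\<close> by linarith
    then show ?thesis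
    proof cases
      case 1
      then show ?thesis by (rule tangent_across[OF that(1,2) m that(3)])
    next
      case 2
      then show ?thesis by (rule tangent_convex[OF that(1,2) m that(3)])
    next
      case 3
      then show ?thesis by (rule tangent_collinear[OF that(1,2) m that(3)])
    next
      case 4
      then show ?thesis by (rule tangent_concave[OF that(1,2) m that(3)])
    qed
  qed
  consider (ii) "X = Infty" "Y = Infty" | (below) c where "X = Infty" "Y = Fin c" "c < y"
    | (above) c where "X = Infty" "Y = Fin c" "y < c"
    | (pl) x' where "X = Fin x'" "Y = Infty" "x' < x" | (pr) x' where "X = Fin x'" "Y = Infty" "x < x'"
    | (left) x' y' where "X = Fin x'" "Y = Fin y'" "x' < x" "y' \<noteq> y"
    | (right) x' y' where "X = Fin x'" "Y = Fin y'" "x < x'" "y' \<noteq> y"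
    using X Y by (cases X; cases Y) (auto simp: neq_iff)
  then show ?thesis
  proof cases
    case ii
    then show ?thesis using tangent_inf_inf[OF m] by simp
  next
    case below
    then show ?thesis using tangent_inf_below[OF f g m] by simp
  next
    case above
    show ?thesis
      by (rule ex1_neg_maps_half_turn)
        (use above tangent_inf_below[OF g f m, of "- c" "- y" "- x"] in \<open>simp add: turn\<close>)
  next
    case pl
    then show ?thesis using tangent_pole_left[OF f g m] by simp
  next
    case pr
    show ?thesis
      by (rule ex1_neg_maps_half_turn)
        (use pr tangent_pole_left[OF g f m, of "- x'" "- x" "- y"] in \<open>simp add: turn\<close>)
  next
    case left
    show ?thesis
      by (rule ex1_neg_maps_half_turn)
        (use left to_right[OF g f, of "- x" "- x'" "- y'" "- y"] in \<open>simp add: turn\<close>)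
  next
    case right
    then show ?thesis using to_right[OF f g] by simp
  qed
qed

lemma neg_maps_slope:
  assumes f: "strongly_hyperbolic f" and g: "strongly_hyperbolic g"
    and h: "h \<in> neg_maps f g" "h (Fin x) = Fin y"
  obtains m where "m < 0" "has_slope h x m"
proof -
  consider a b c where "0 < a" "h = hyp_map f g a b c" | s t where "s < 0" "h = lin_map s t"
    using h(1) by (auto simp: neg_maps_def)
  then show thesis
  proof cases
    case (1 a b c)
    have "a * deriv f (x + b) < 0" if "- b < x" using 1 that sh_deriv_neg[OF f, of "x + b"] by (simp add: mult_pos_neg)
    moreover have "a * deriv g (- x - b) < 0" if "x < - b" using 1 that sh_deriv_neg[OF g, of "- x - b"] by (simp add: mult_pos_neg)
    moreover have "- b < x \<or> x < - b" using h(2) 1 by (auto simp: hyp_map_fin_iff[OF f g])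
    ultimately show thesis using that 1(2) has_slope_right[OF f] has_slope_left[OF g] by metis
  next
    case 2
    then show thesis using that by auto
  qed
qed

lemma neg_maps_finite_near:
  assumes "h \<in> neg_maps f g" "h (Fin x) \<noteq> Infty"
  shows "\<exists>e>0. \<forall>x'. \<bar>x' - x\<bar> < e \<longrightarrow> h (Fin x') \<noteq> Infty"
proof -
  consider a b c where "h = hyp_map f g a b c" | s t where "h = lin_map s t"
    using assms(1) by (auto simp: neg_maps_def)
  then show ?thesis
  proof cases
    case (1 a b c)
    then have "x \<noteq> - b" using assms(2) by auto
    then show ?thesis using 1 by (intro exI[of _ "\<bar>x + b\<bar>"]) auto
  next
    case 2
    then show ?thesis by (intro exI[of _ 1]) auto
  qed
qed

lemma neg_maps_transversal:
  assumes f: "strongly_hyperbolic f" and g: "strongly_hyperbolic g"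
    and h: "h \<in> neg_maps f g" "h (Fin x) = Fin y" "has_slope h x m"
    and k: "k \<in> neg_maps f g" "k (Fin x) = Fin y" "has_slope k x m'"
    and neg: "m < m'" "m' < 0"
  shows "\<exists>Z. Z \<noteq> Fin x \<and> h Z = k Z"
proof -
  let ?h = "\<lambda>x. the_fin (h (Fin x))" and ?k = "\<lambda>x. the_fin (k (Fin x))"
  have D: "(?h has_real_derivative m) (at x)" "(?k has_real_derivative m') (at x)"
    "((\<lambda>x. ?k x - ?h x) has_real_derivative m' - m) (at x)"
    using h(3) k(3) by (auto simp: has_slope_def intro: DERIV_diff)
  obtain e1 e2 where e: "0 < e1" "\<And>x'. \<bar>x' - x\<bar> < e1 \<Longrightarrow> h (Fin x') \<noteq> Infty"
      "0 < e2" "\<And>x'. \<bar>x' - x\<bar> < e2 \<Longrightarrow> k (Fin x') \<noteq> Infty"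
    using neg_maps_finite_near[OF h(1)] neg_maps_finite_near[OF k(1)] h(2) k(2) by (metis s1.distinct(1))
  have fin: "h (Fin x') = Fin (?h x')" "k (Fin x') = Fin (?k x')" if "\<bar>x' - x\<bar> < min e1 e2" for x'
    using e(2,4)[of x'] that by (cases "h (Fin x')"; cases "k (Fin x')"; simp)+
  \<comment> \<open>In the cyclic order seen from \<open>Fin y\<close>, two finite values compare as
    usual only if they lie on the same side of \<open>y\<close>. So the values are also compared
    with \<open>y\<close>: both maps are below it to the right of \<open>x\<close> and above it to
    the left.\<close>
  obtain d1 where d1: "0 < d1" "\<And>t. 0 < t \<Longrightarrow> t < d1 \<Longrightarrow> ?k (x + t) < y"
    using DERIV_neg_dec_right[OF D(2)] neg k(2) by auto
  obtain d2 where d2: "0 < d2" "\<And>t. 0 < t \<Longrightarrow> t < d2 \<Longrightarrow> ?h (x + t) < ?k (x + t)"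
    using DERIV_pos_inc_right[OF D(3)] neg h(2) k(2) by auto
  obtain d3 where d3: "0 < d3" "\<And>t. 0 < t \<Longrightarrow> t < d3 \<Longrightarrow> y < ?k (x - t)"
    using DERIV_neg_dec_left[OF D(2)] neg k(2) by auto
  obtain d4 where d4: "0 < d4" "\<And>t. 0 < t \<Longrightarrow> t < d4 \<Longrightarrow> ?k (x - t) < ?h (x - t)"
    using DERIV_pos_inc_left[OF D(3)] neg h(2) k(2) by auto
  define t where "t = Min {e1, e2, d1, d2, d3, d4} / 2"
  have "0 < Min {e1, e2, d1, d2, d3, d4}" using e(1,3) d1(1) d2(1) d3(1) d4(1) by simp
  then have t: "0 < t" "t < e1" "t < e2" "t < d1" "t < d2" "t < d3" "t < d4"
    unfolding t_def by auto
  have "\<bar>x + t - x\<bar> < min e1 e2" "\<bar>x - t - x\<bar> < min e1 e2" using t by auto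
  note fin' = fin[OF this(1)] fin[OF this(2)]
  have "cyc (Fin y) (h (Fin (x + t))) (k (Fin (x + t)))"
    by (subst fin'(1), subst fin'(2)) (use d1(2)[of t] d2(2)[of t] t in simp)
  moreover have "cyc (Fin y) (k (Fin (x - t))) (h (Fin (x - t)))"
    by (subst fin'(3), subst fin'(4)) (use d3(2)[of t] d4(2)[of t] t in simp)
  ultimately show ?thesis
    using cyc_rev_crossing neg_maps_cyc_rev[OF f g h(1)] neg_maps_cyc_rev[OF f g k(1)] h(2) k(2) by blast
qed

lemma touch_finite:
  assumes f: "strongly_hyperbolic f" and g: "strongly_hyperbolic g"
    and h: "h \<in> neg_maps f g" "h (Fin x) = Fin y"
    and X: "X \<noteq> Fin x" "Y \<noteq> Fin y" "h X \<noteq> Y"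
  shows "\<exists>!k. k \<in> neg_maps f g \<and> k (Fin x) = Fin y \<and> k X = Y \<and> (\<forall>Z. h Z = k Z \<longrightarrow> Z = Fin x)"
proof -
  obtain m where m: "m < 0" "has_slope h x m" using neg_maps_slope[OF f g h] .
  obtain k where k: "k \<in> neg_maps f g" "k (Fin x) = Fin y" "has_slope k x m" "k X = Y"
    and uniq: "\<And>k'. \<lbrakk>k' \<in> neg_maps f g; k' (Fin x) = Fin y; has_slope k' x m; k' X = Y\<rbrakk> \<Longrightarrow> k' = k"
    using tangent_neg_maps[OF f g m(1) X(1,2)] by blast
  show ?thesis
  proof (rule ex1I[of _ k])
    have "Z = Fin x" if "h Z = k Z" for Z
    proof (rule ccontr)
      assume Z: "Z \<noteq> Fin x"
      then have "h Z \<noteq> Fin y" using cyc_rev_inj[OF neg_maps_cyc_rev(1)[OF f g h(1)]] h(2) by (metis injD)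
      \<comment> \<open>Both maps solve the tangent problem whose second point is
        \<open>(Z, h Z)\<close>.\<close>
      then have "h = k" using tangent_neg_maps[OF f g m(1) Z] h k m(2) that by metis
      then show False using k X by simp
    qed
    then show "k \<in> neg_maps f g \<and> k (Fin x) = Fin y \<and> k X = Y \<and> (\<forall>Z. h Z = k Z \<longrightarrow> Z = Fin x)"
      using k by blast
  next
    fix k' assume k': "k' \<in> neg_maps f g \<and> k' (Fin x) = Fin y \<and> k' X = Y \<and> (\<forall>Z. h Z = k' Z \<longrightarrow> Z = Fin x)"
    then obtain m' where m': "m' < 0" "has_slope k' x m'" using neg_maps_slope[OF f g] by metis
    have "m' = m"
    proof (rule ccontr)
      assume "m' \<noteq> m"
      then consider "m < m'" | "m' < m" by linarith
      then show False
        using neg_maps_transversal[OF f g h m(2), of k' m'] neg_maps_transversal[OF f g _ _ m'(2) h m(2)] k' m(1) m'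
        by cases metis+
    qed
    then show "k' = k" using uniq k' m' by blast
  qed
qed

text \<open>Only lines pass through the point with both coordinates infinite, and touching there
  means being parallel.\<close>

lemma touch_inf_inf:
  assumes h: "h \<in> neg_maps f g" "h Infty = Infty"
    and X: "X \<noteq> Infty" "Y \<noteq> Infty" "h X \<noteq> Y"
  shows "\<exists>!k. k \<in> neg_maps f g \<and> k Infty = Infty \<and> k X = Y \<and> (\<forall>Z. h Z = k Z \<longrightarrow> Z = Infty)"
proof -
  obtain s t where s: "s < 0" "h = lin_map s t" using h by (auto simp: neg_maps_def)
  obtain x y where xy: "X = Fin x" "Y = Fin y" using X by (cases X; cases Y) auto
  have parallel: "(\<forall>Z. h Z = lin_map s' t' Z \<longrightarrow> Z = Infty) \<longleftrightarrow> s' = s \<and> t' \<noteq> t" for s' t'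
  proof
    assume *: "\<forall>Z. h Z = lin_map s' t' Z \<longrightarrow> Z = Infty"
    have "s' = s"
    proof (rule ccontr)
      assume "s' \<noteq> s"
      then have "s * ((t' - t) / (s - s')) + t = s' * ((t' - t) / (s - s')) + t'" by (simp add: field_simps)
      then show False using *[rule_format, of "Fin ((t' - t) / (s - s'))"] s by simp
    qed
    then show "s' = s \<and> t' \<noteq> t" using *[rule_format, of "Fin 0"] s by auto
  next
    assume "s' = s \<and> t' \<noteq> t"
    then show "\<forall>Z. h Z = lin_map s' t' Z \<longrightarrow> Z = Infty"
      using s by (metis add_left_cancel lin_map_simps(2) s1.exhaust s1.inject)
  qed
  show ?thesis
  proof (rule ex1_neg_maps_lin[of s _ "y - s * x", OF s(1)])
    show "lin_map s (y - s * x) Infty = Infty \<and> lin_map s (y - s * x) X = Y \<and> (\<forall>Z. h Z = lin_map s (y - s * x) Z \<longrightarrow> Z = Infty)"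
      unfolding parallel using xy X s by auto
    show "s' = s \<and> t' = y - s * x"
      if "lin_map s' t' Infty = Infty \<and> lin_map s' t' X = Y \<and> (\<forall>Z. h Z = lin_map s' t' Z \<longrightarrow> Z = Infty)" for s' t'
      using that unfolding parallel using xy by auto
  qed auto
qed

text \<open>Between the two poles one map is above \<open>c\<close> and the other below, so common
  points lie on like branches, where equal factors contradict strict decrease. For unequal factors
  \<open>sh_ex1_ratio_shift\<close> gives a meeting, on the right if \<open>a < a'\<close> and on
  the left if \<open>a' < a\<close>.\<close>

lemma hyp_map_same_level_meet:
  assumes f: "strongly_hyperbolic f" and g: "strongly_hyperbolic g" and "0 < a" "0 < a'" "b < b'"
  shows "(\<exists>Z. Z \<noteq> Infty \<and> hyp_map f g a b c Z = hyp_map f g a' b' c Z) \<longleftrightarrow> a \<noteq> a'"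
proof
  assume "\<exists>Z. Z \<noteq> Infty \<and> hyp_map f g a b c Z = hyp_map f g a' b' c Z"
  then obtain z where z: "hyp_map f g a b c (Fin z) = hyp_map f g a' b' c (Fin z)"
    by (metis s1.exhaust)
  have "hyp_map f g a b c (Fin z) \<noteq> Infty"
    using z assms(5) by (metis add.inverse_inverse hyp_map_simps(3) less_irrefl s1.inject)
  then obtain y where y: "hyp_map f g a b c (Fin z) = Fin y" "hyp_map f g a' b' c (Fin z) = Fin y"
    using z by (metis s1.exhaust)
  then have "a * f (z + b) = a' * f (z + b') \<and> - b < z \<or> a * g (- z - b) = a' * g (- z - b') \<and> z < - b'"
    unfolding hyp_map_fin_iff[OF f g assms(3)] hyp_map_fin_iff[OF f g assms(4)] using assms by auto
  then show "a \<noteq> a'"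
    using sh_strict_decreasing[OF f, of "z + b" "z + b'"] sh_strict_decreasing[OF g, of "- z - b'" "- z - b"] assms by auto
next
  assume "a \<noteq> a'"
  then consider "1 < a' / a" | "1 < a / a'" using assms by (auto simp: neq_iff)
  then show "\<exists>Z. Z \<noteq> Infty \<and> hyp_map f g a b c Z = hyp_map f g a' b' c Z"
  proof cases
    case 1
    then obtain u where u: "0 < u" "f u = a' / a * f (u + (b' - b))"
      using sh_ex1_ratio_shift[OF f, of "a' / a" "b' - b"] assms by auto
    have "a * f u = a' * f (u + (b' - b))" using u(2) assms by simp
    then show ?thesis
      using u assms by (intro exI[of _ "Fin (u - b)"]) (simp add: hyp_map_right algebra_simps)
  next
    case 2
    then obtain u where u: "0 < u" "g u = a / a' * g (u + (b' - b))"
      using sh_ex1_ratio_shift[OF g, of "a / a'" "b' - b"] assms by auto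
    have "a' * g u = a * g (u + (b' - b))" using u(2) assms by simp
    then show ?thesis
      using u assms by (intro exI[of _ "Fin (- u - b')"]) (simp add: hyp_map_left algebra_simps)
  qed
qed

text \<open>For touching at the finite level \<open>c\<close> over infinity both \<open>a\<close>
  and \<open>c\<close> are fixed, and the shift is the only freedom left for passing through a
  second point.\<close>

lemma hyp_map_ex1_shift:
  assumes f: "strongly_hyperbolic f" and g: "strongly_hyperbolic g" and a: "0 < a" and Y: "Y \<noteq> Fin c"
  shows "\<exists>!b. hyp_map f g a b c (Fin x) = Y"
proof (cases Y)
  case (Fin y)
  then consider "c < y" | "y < c" using Y by (auto simp: neq_iff)
  then show ?thesis
  proof cases
    case 1
    then obtain u where u: "0 < u" "f u = (y - c) / a" "\<And>u'. \<lbrakk>0 < u'; f u' = (y - c) / a\<rbrakk> \<Longrightarrow> u' = u"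
      using sh_ex1_value[OF f, of "(y - c) / a"] divide_pos_pos[of "y - c" a] a by (metis diff_gt_0_iff_gt)
    show ?thesis
    proof (rule ex1I[of _ "u - x"])
      show "hyp_map f g a (u - x) c (Fin x) = Y" using u(1,2) a Fin by (simp add: hyp_map_right)
      show "b = u - x" if "hyp_map f g a b c (Fin x) = Y" for b
        using that u(3)[of "x + b"] a 1 unfolding Fin hyp_map_fin_iff[OF f g a] by auto
    qed
  next
    case 2
    then obtain u where u: "0 < u" "g u = (c - y) / a" "\<And>u'. \<lbrakk>0 < u'; g u' = (c - y) / a\<rbrakk> \<Longrightarrow> u' = u"
      using sh_ex1_value[OF g, of "(c - y) / a"] divide_pos_pos[of "c - y" a] a by (metis diff_gt_0_iff_gt)
    show ?thesis
    proof (rule ex1I[of _ "- u - x"])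
      show "hyp_map f g a (- u - x) c (Fin x) = Y" using u(1,2) a Fin by (simp add: hyp_map_left)
      show "b = - u - x" if "hyp_map f g a b c (Fin x) = Y" for b
        using that u(3)[of "- x - b"] a 2 unfolding Fin hyp_map_fin_iff[OF f g a] by auto
    qed
  qed
next
  case Infty
  then show ?thesis by (intro ex1I[of _ "- x"]) auto
qed

lemma touch_inf_fin:
  assumes f: "strongly_hyperbolic f" and g: "strongly_hyperbolic g"
    and h: "h \<in> neg_maps f g" "h Infty = Fin c"
    and X: "X \<noteq> Infty" "Y \<noteq> Fin c" "h X \<noteq> Y"
  shows "\<exists>!k. k \<in> neg_maps f g \<and> k Infty = Fin c \<and> k X = Y \<and> (\<forall>Z. h Z = k Z \<longrightarrow> Z = Infty)"
proof -
  obtain a b where a: "0 < a" "h = hyp_map f g a b c" using h by (auto simp: neg_maps_def)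
  obtain x where x: "X = Fin x" using X by (cases X) auto
  obtain b' where b': "hyp_map f g a b' c X = Y" "\<And>b''. hyp_map f g a b'' c X = Y \<Longrightarrow> b'' = b'"
    using hyp_map_ex1_shift[OF f g a(1) X(2), of x] x by auto
  have touch: "(\<forall>Z. h Z = hyp_map f g a' b'' c Z \<longrightarrow> Z = Infty) \<longleftrightarrow> a' = a"
    if "0 < a'" "b'' \<noteq> b" for a' b''
  proof (cases "b < b''")
    case True
    show ?thesis using hyp_map_same_level_meet[OF f g a(1) that(1) True, of c] a(2) by auto
  next
    case False
    then have "b'' < b" using that by simp
    from hyp_map_same_level_meet[OF f g that(1) a(1) this, of c] show ?thesis using a(2) by (metis)
  qed
  show ?thesis
  proof (rule ex1_neg_maps_hyp[of a _ _ _ b' c, OF a(1)])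
    have "b' \<noteq> b" using b'(1) X(3) a(2) by auto
    then show "hyp_map f g a b' c Infty = Fin c \<and> hyp_map f g a b' c X = Y \<and> (\<forall>Z. h Z = hyp_map f g a b' c Z \<longrightarrow> Z = Infty)"
      using touch[OF a(1)] b'(1) by auto
  next
    fix a' b'' c'
    assume a': "0 < a'" and Q: "hyp_map f g a' b'' c' Infty = Fin c \<and> hyp_map f g a' b'' c' X = Y \<and> (\<forall>Z. h Z = hyp_map f g a' b'' c' Z \<longrightarrow> Z = Infty)"
    then have c': "c' = c" by simp
    \<comment> \<open>Equal shifts mean a common pole, which would be a second common point.\<close>
    have "b'' \<noteq> b"
    proof
      assume "b'' = b"
      then have "h (Fin (- b)) = hyp_map f g a' b'' c' (Fin (- b))" using a(2) by simp
      then show False using Q by blast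
    qed
    then have "a' = a" using touch[OF a'] Q c' by simp
    then show "b'' = b' \<and> a' = a \<and> c' = c" using b'(2) Q c' by simp
  qed auto
qed

text \<open>Circles with the same pole differ only in \<open>a\<close> and \<open>c\<close>: equal
  factors make them vertical translates, which share nothing but the pole.\<close>

lemma touch_fin_inf:
  assumes f: "strongly_hyperbolic f" and g: "strongly_hyperbolic g"
    and h: "h \<in> neg_maps f g" "h (Fin x) = Infty"
    and X: "X \<noteq> Fin x" "Y \<noteq> Infty" "h X \<noteq> Y"
  shows "\<exists>!k. k \<in> neg_maps f g \<and> k (Fin x) = Infty \<and> k X = Y \<and> (\<forall>Z. h Z = k Z \<longrightarrow> Z = Fin x)"
proof -
  obtain a c where a: "0 < a" "h = hyp_map f g a (- x) c" using h by (auto simp: neg_maps_def)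
  have pole: "hyp_map f g a' (- x) c' (Fin x) = Infty" for a' c' by simp
  obtain y where y: "Y = Fin y" using X by (cases Y) auto
  have "\<exists>d. \<forall>c'. hyp_map f g a (- x) c' X = Fin (d + c')"
  proof (cases X)
    case (Fin z)
    then consider "x < z" | "z < x" using X by (auto simp: neq_iff)
    then show ?thesis
    proof cases
      case 1
      then show ?thesis using Fin by (intro exI[of _ "a * f (z - x)"]) (simp add: hyp_map_right)
    next
      case 2
      then show ?thesis using Fin by (intro exI[of _ "- a * g (- z + x)"]) (simp add: hyp_map_left)
    qed
  next
    case Infty
    then show ?thesis by (intro exI[of _ 0]) auto
  qed
  then obtain d where d: "\<And>c'. hyp_map f g a (- x) c' X = Fin (d + c')" by blast
  have touch: "(\<forall>Z. h Z = hyp_map f g a' (- x) c' Z \<longrightarrow> Z = Fin x) \<longleftrightarrow> a' = a"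
    if a': "0 < a'" and c': "c' \<noteq> c" for a' c'
  proof
    assume "a' = a"
    then have "h Z \<noteq> hyp_map f g a' (- x) c' Z" if "Z \<noteq> Fin x" for Z
      using a(2) c' that by (cases Z) (auto simp: hyp_map_def f_abc_def)
    then show "\<forall>Z. h Z = hyp_map f g a' (- x) c' Z \<longrightarrow> Z = Fin x" by blast
  next
    assume *: "\<forall>Z. h Z = hyp_map f g a' (- x) c' Z \<longrightarrow> Z = Fin x"
    show "a' = a"
    proof (rule ccontr)
      assume ne: "a' \<noteq> a"
      \<comment> \<open>The two maps agree where \<open>f\<close>, or the negative of
        \<open>g\<close> on the left branch, takes this value; its sign decides the branch.\<close>
      define q where "q = (c' - c) / (a - a')"
      have q: "a * q + c = a' * q + c'" "q \<noteq> 0" using ne c' by (auto simp: q_def field_simps)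
      then consider "0 < q" | "0 < - q" by linarith
      then show False
      proof cases
        case 1
        then obtain u where "0 < u" "f u = q" using sh_ex1_value[OF f] by blast
        then show False using *[rule_format, of "Fin (x + u)"] q(1) a(2) by (simp add: hyp_map_right)
      next
        case 2
        then obtain u where u: "0 < u" "g u = - q" using sh_ex1_value[OF g] by blast
        then show False using *[rule_format, of "Fin (x - u)"] q(1) a(2) by (simp add: hyp_map_left)
      qed
    qed
  qed
  show ?thesis
  proof (rule ex1_neg_maps_hyp[of a _ _ _ "- x" "y - d", OF a(1)])
    have "y - d \<noteq> c" using X(3) a(2) d y by auto
    then show "hyp_map f g a (- x) (y - d) (Fin x) = Infty \<and> hyp_map f g a (- x) (y - d) X = Y
        \<and> (\<forall>Z. h Z = hyp_map f g a (- x) (y - d) Z \<longrightarrow> Z = Fin x)"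
      using touch[OF a(1)] d y by simp
  next
    fix a' b' c'
    assume a': "0 < a'" and Q: "hyp_map f g a' b' c' (Fin x) = Infty \<and> hyp_map f g a' b' c' X = Y
        \<and> (\<forall>Z. h Z = hyp_map f g a' b' c' Z \<longrightarrow> Z = Fin x)"
    then have b': "b' = - x" by simp
    \<comment> \<open>Equal levels would give a second common point over
      \<open>Infty\<close>.\<close>
    have "c' \<noteq> c"
    proof
      assume "c' = c"
      then have "h Infty = hyp_map f g a' b' c' Infty" using a(2) by simp
      then show False using Q by blast
    qed
    then have "a' = a" using touch[OF a'] Q b' by simp
    then show "b' = - x \<and> a' = a \<and> c' = y - d" using Q b' d[of c'] y by auto
  qed auto
qed

lemma touch_neg_maps:
  assumes f: "strongly_hyperbolic f" and g: "strongly_hyperbolic g"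
    and h: "h \<in> neg_maps f g" "h P = Q" and X: "X \<noteq> P" "Y \<noteq> Q" "h X \<noteq> Y"
  shows "\<exists>!k. k \<in> neg_maps f g \<and> k P = Q \<and> k X = Y \<and> (\<forall>Z. h Z = k Z \<longrightarrow> Z = P)"
  using assms touch_finite touch_fin_inf touch_inf_fin touch_inf_inf
  by (cases P; cases Q) simp_all

section \<open>The two families together\<close>

definition plane_maps :: "(real \<Rightarrow> real) \<Rightarrow> (real \<Rightarrow> real) \<Rightarrow> (real \<Rightarrow> real) \<Rightarrow> (real \<Rightarrow> real) \<Rightarrow> (s1 \<Rightarrow> s1) set" where
  "plane_maps f1 f2 f3 f4 = neg_maps f1 f2 \<union> {h. h \<circ> s1_neg \<in> neg_maps f3 f4}"

lemma comp_s1_neg_comp [simp]: "h \<circ> s1_neg \<circ> s1_neg = h"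
  by (auto simp: fun_eq_iff)

lemma plane_maps_mirror: "h \<circ> s1_neg \<in> plane_maps f1 f2 f3 f4 \<longleftrightarrow> h \<in> plane_maps f3 f4 f1 f2"
  by (auto simp: plane_maps_def)

lemma circles_plane_maps: "C_minus f1 f2 \<union> C_plus f3 f4 = graph ` plane_maps f1 f2 f3 f4"
proof -
  have "(\<lambda>h. graph (h \<circ> s1_neg)) ` neg_maps f3 f4 = graph ` {h. h \<circ> s1_neg \<in> neg_maps f3 f4}"
    by (auto intro!: image_eqI[of _ _ "_ \<circ> s1_neg"])
  then show ?thesis
    by (simp add: C_minus_graph C_plus_graph plane_maps_def image_Un)
qed

text \<open>The reflection exchanges the two families, so it is enough to treat configurations and
  circles of the order-reversing kind.\<close>

lemma ex1_plane_maps_mirror: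
  assumes "\<exists>!h. h \<in> plane_maps f3 f4 f1 f2 \<and> Q (h \<circ> s1_neg)"
  shows "\<exists>!h. h \<in> plane_maps f1 f2 f3 f4 \<and> Q h"
  using assms plane_maps_mirror comp_s1_neg_comp by metis

lemma join_plane_maps_neg:
  assumes sh: "strongly_hyperbolic f1" "strongly_hyperbolic f2" "strongly_hyperbolic f3" "strongly_hyperbolic f4"
    and X: "cyc X1 X2 X3" and Y: "cyc Y3 Y2 Y1"
  shows "\<exists>!h. h \<in> plane_maps f1 f2 f3 f4 \<and> h X1 = Y1 \<and> h X2 = Y2 \<and> h X3 = Y3"
proof -
  have "\<not> (h X1 = Y1 \<and> h X2 = Y2 \<and> h X3 = Y3)" if "h \<circ> s1_neg \<in> neg_maps f3 f4" for h
  proof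
    assume *: "h X1 = Y1 \<and> h X2 = Y2 \<and> h X3 = Y3"
    have "cyc (s1_neg X3) (s1_neg X2) (s1_neg X1)" using X by simp
    then have "cyc ((h \<circ> s1_neg) (s1_neg X1)) ((h \<circ> s1_neg) (s1_neg X2)) ((h \<circ> s1_neg) (s1_neg X3))"
      using neg_maps_cyc_rev(1)[OF sh(3,4) that] unfolding cyc_rev_def by blast
    then show False using * Y cyc_asym by auto
  qed
  then show ?thesis using join_neg_maps[OF sh(1,2) X Y] unfolding plane_maps_def by (metis (mono_tags, lifting) Un_iff mem_Collect_eq)
qed

lemma join_plane_maps:
  assumes sh: "strongly_hyperbolic f1" "strongly_hyperbolic f2" "strongly_hyperbolic f3" "strongly_hyperbolic f4"
    and X: "X1 \<noteq> X2" "X2 \<noteq> X3" "X3 \<noteq> X1" and Y: "Y1 \<noteq> Y2" "Y2 \<noteq> Y3" "Y3 \<noteq> Y1"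
  shows "\<exists>!h. h \<in> plane_maps f1 f2 f3 f4 \<and> h X1 = Y1 \<and> h X2 = Y2 \<and> h X3 = Y3"
proof -
  have oriented: "\<exists>!h. h \<in> plane_maps f1 f2 f3 f4 \<and> h X1 = Y1 \<and> h X2 = Y2 \<and> h X3 = Y3"
    if X: "cyc X1 X2 X3" and Y: "Y1 \<noteq> Y2" "Y2 \<noteq> Y3" "Y3 \<noteq> Y1" for X1 X2 X3 Y1 Y2 Y3
  proof (cases "cyc Y3 Y2 Y1")
    case True
    then show ?thesis by (rule join_plane_maps_neg[OF sh X])
  next
    case False
    then have "cyc Y1 Y2 Y3" using cyc_total Y by metis
    then have "\<exists>!h. h \<in> plane_maps f3 f4 f1 f2 \<and> h (s1_neg X3) = Y3 \<and> h (s1_neg X2) = Y2 \<and> h (s1_neg X1) = Y1"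
      by (intro join_plane_maps_neg sh) (use X in auto)
    then show ?thesis
      by - (rule ex1_plane_maps_mirror, simp add: conj_ac)
  qed
  from X cyc_total consider "cyc X1 X2 X3" | "cyc X3 X2 X1" by metis
  then show ?thesis
  proof cases
    case 1
    then show ?thesis using oriented Y by blast
  next
    case 2
    then have "\<exists>!h. h \<in> plane_maps f1 f2 f3 f4 \<and> h X3 = Y3 \<and> h X2 = Y2 \<and> h X1 = Y1"
      using oriented[of X3 X2 X1 Y3 Y2 Y1] Y by metis
    then show ?thesis by (simp add: conj_ac)
  qed
qed

lemma touch_plane_maps:
  assumes sh: "strongly_hyperbolic f1" "strongly_hyperbolic f2" "strongly_hyperbolic f3" "strongly_hyperbolic f4"
    and h: "h \<in> plane_maps f1 f2 f3 f4" "h P = Q" and X: "X \<noteq> P" "Y \<noteq> Q" "h X \<noteq> Y"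
  shows "\<exists>!k. k \<in> plane_maps f1 f2 f3 f4 \<and> k P = Q \<and> k X = Y \<and> (\<forall>Z. h Z = k Z \<longrightarrow> Z = P)"
proof -
  have neg: "\<exists>!k. k \<in> plane_maps f1 f2 f3 f4 \<and> k P = Q \<and> k X = Y \<and> (\<forall>Z. h Z = k Z \<longrightarrow> Z = P)"
    if sh: "strongly_hyperbolic f1" "strongly_hyperbolic f2" "strongly_hyperbolic f3" "strongly_hyperbolic f4"
      and h: "h \<in> neg_maps f1 f2" "h P = Q" and X: "X \<noteq> P" "Y \<noteq> Q" "h X \<noteq> Y" for f1 f2 f3 f4 h P Q X Y
  proof -
    \<comment> \<open>No map of the opposite orientation can touch \<open>h\<close> at
      \<open>P\<close>, so the search is confined to the family of \<open>h\<close>.\<close>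
    have "\<exists>Z. Z \<noteq> P \<and> h Z = k Z" if k: "k \<circ> s1_neg \<in> neg_maps f3 f4" "k P = Q" for k
    proof (rule cyc_rev_pres_meet_twice[of h P Q k])
      have "surj (k \<circ> s1_neg)" using neg_maps_cyc_rev[OF sh(3,4) k(1)] by blast
      then show "surj k" unfolding surj_def by (metis comp_apply)
    qed (use neg_maps_cyc_rev[OF sh(1,2) h(1)] neg_maps_cyc_rev[OF sh(3,4) k(1)] h k in auto)
    then show ?thesis
      using touch_neg_maps[OF sh(1,2) h X] unfolding plane_maps_def
      by (metis (mono_tags, lifting) Un_iff mem_Collect_eq)
  qed
  from h(1) consider "h \<in> neg_maps f1 f2" | (pos) "h \<circ> s1_neg \<in> neg_maps f3 f4" by (auto simp: plane_maps_def)
  then show ?thesis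
  proof cases
    case pos
    have flip: "(\<forall>Z. (h \<circ> s1_neg) Z = k Z \<longrightarrow> Z = s1_neg P) \<longleftrightarrow> (\<forall>Z. h Z = (k \<circ> s1_neg) Z \<longrightarrow> Z = P)" for k
      by (metis comp_apply s1_neg_neg)
    have "\<exists>!k. k \<in> plane_maps f3 f4 f1 f2 \<and> k (s1_neg P) = Q \<and> k (s1_neg X) = Y
        \<and> (\<forall>Z. (h \<circ> s1_neg) Z = k Z \<longrightarrow> Z = s1_neg P)"
      by (rule neg[OF sh(3,4,1,2) pos]) (use h X in auto)
    then show ?thesis
      unfolding flip by - (rule ex1_plane_maps_mirror, simp)
  qed (use neg sh h X in blast)
qed

lemma plane_maps_homeomorphism:
  assumes sh: "strongly_hyperbolic f1" "strongly_hyperbolic f2" "strongly_hyperbolic f3" "strongly_hyperbolic f4"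
    and h: "h \<in> plane_maps f1 f2 f3 f4"
  shows "\<exists>k. homeomorphism UNIV UNIV h k"
proof -
  have neg: "homeomorphism UNIV UNIV s1_neg (inv s1_neg)"
    by (rule cyc_rev_homeomorphism) (auto simp: cyc_rev_def surj_def intro: exI[of _ "s1_neg _"] s1_neg_neg[symmetric])
  from h consider "h \<in> neg_maps f1 f2" | "h \<circ> s1_neg \<in> neg_maps f3 f4" by (auto simp: plane_maps_def)
  then show ?thesis
  proof cases
    case 1
    then show ?thesis using cyc_rev_homeomorphism neg_maps_cyc_rev[OF sh(1,2)] by blast
  next
    case 2
    then have "homeomorphism UNIV UNIV (h \<circ> s1_neg) (inv (h \<circ> s1_neg))"
      using cyc_rev_homeomorphism neg_maps_cyc_rev[OF sh(3,4)] by blast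
    from homeomorphism_compose[OF neg this] show ?thesis by auto
  qed
qed

lemma ex1_graph:
  assumes "\<exists>!h. h \<in> G \<and> Q (graph h)"
  shows "\<exists>!C. C \<in> graph ` G \<and> Q C"
  using assms by (metis (no_types, lifting) graph_inject image_iff)

theorem theorem4p1:
  fixes f1 f2 f3 f4 :: "real \<Rightarrow> real"
  assumes "strongly_hyperbolic f1" and "strongly_hyperbolic f2"
      and "strongly_hyperbolic f3" and "strongly_hyperbolic f4"
  shows "flat_minkowski_plane (C_minus f1 f2 \<union> C_plus f3 f4)"
  unfolding circles_plane_maps flat_minkowski_plane_def
proof (intro conjI ballI allI impI)
  fix C assume "C \<in> graph ` plane_maps f1 f2 f3 f4"
  then show "\<exists>g h. homeomorphism UNIV UNIV g h \<and> C = {(x, g x) | x. True}"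
    using plane_maps_homeomorphism[OF assms] unfolding graph_def by blast
next
  fix p q r :: point
  assume np: "\<not> parallel p q \<and> \<not> parallel p r \<and> \<not> parallel q r"
  show "\<exists>!C. C \<in> graph ` plane_maps f1 f2 f3 f4 \<and> p \<in> C \<and> q \<in> C \<and> r \<in> C"
  proof (rule ex1_graph)
    obtain X1 Y1 X2 Y2 X3 Y3 where eq: "p = (X1, Y1)" "q = (X2, Y2)" "r = (X3, Y3)"
      by (cases p, cases q, cases r)
    show "\<exists>!h. h \<in> plane_maps f1 f2 f3 f4 \<and> p \<in> graph h \<and> q \<in> graph h \<and> r \<in> graph h"
      unfolding eq graph_mem
      by (rule join_plane_maps[OF assms])
        (use np eq in \<open>auto simp: parallel_def plus_parallel_def minus_parallel_def\<close>)
  qed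
next
  fix C p q
  assume C: "C \<in> graph ` plane_maps f1 f2 f3 f4" and pq: "p \<in> C \<and> q \<notin> C \<and> \<not> parallel p q"
  obtain h where h: "C = graph h" "h \<in> plane_maps f1 f2 f3 f4" using C by blast
  obtain P Q X Y where eq: "p = (P, Q)" "q = (X, Y)" by (cases p, cases q)
  have "graph h \<inter> graph k = {(P, Q)} \<longleftrightarrow> (\<forall>Z. h Z = k Z \<longrightarrow> Z = P)" if "h P = Q" "k P = Q" for k
    using that by (auto simp: graph_def set_eq_iff)
  then have "k P = Q \<and> k X = Y \<and> graph h \<inter> graph k = {(P, Q)} \<longleftrightarrow> k P = Q \<and> k X = Y \<and> (\<forall>Z. h Z = k Z \<longrightarrow> Z = P)" for k
    using pq h eq by auto
  moreover have "\<exists>!k. k \<in> plane_maps f1 f2 f3 f4 \<and> k P = Q \<and> k X = Y \<and> (\<forall>Z. h Z = k Z \<longrightarrow> Z = P)"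
    by (rule touch_plane_maps[OF assms h(2)])
      (use pq h eq in \<open>auto simp: parallel_def plus_parallel_def minus_parallel_def\<close>)
  ultimately show "\<exists>!D. D \<in> graph ` plane_maps f1 f2 f3 f4 \<and> p \<in> D \<and> q \<in> D \<and> C \<inter> D = {p}"
    unfolding h(1) eq by (intro ex1_graph) simp
qed

end
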